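(* For every integer $n\ge 1$, let $K_{n,1}$ be the welded knot represented by the diagram obtained from the standard diagram of the torus knot $K(2,2n+1)$ by welding one crossing. Then $G(K_{n,1})\cong\mathbb{Z}$.
   Context: A virtual knot diagram is the image of a generic immersion $S^1\to\mathbb{R}^2$ with finitely many transverse double points, each marked either as a classical crossing (with over/under information) or as a virtual (also called welded) crossing. A welded knot is an equivalence class of virtual knot diagrams under planar isotopy and finite sequences of: the classical Reidemeister moves; the virtual Reidemeister moves $vR_1,vR_2,vR_3$ (analogues of the Reidemeister moves with all crossings virtual); $vR_4$ (a strand having two consecutive virtual crossings is slid across a classical crossing); and the over-forbidden move $F_o$ (a strand that is the over-strand at two consecutive classical crossings is slid across a virtual crossing of the two other strands). Welding a classical crossing means replacing it by a virtual (welded) crossing. The fundamental group $G(K)$ of a welded knot $K$ is given by the Wirtinger presentation of any of its oriented diagrams: the generators are the arcs, an arc being the part of the diagram between two consecutive under-crossings (arcs continue through virtual crossings); each classical crossing with over-arc $y$ and under-arcs $x_r$ (on the right of the oriented over-arc) and $x_l$ (on its left) gives the relation $x_l=y\,x_r\,y^{-1}$; virtual crossings give no relation. (The opposite conjugation convention yields an isomorphic group.) The standard diagram of $K(2,2n+1)$ is the closure of the 2-braid $\sigma_1^{2n+1}$, with $2n+1$ crossings. By the cyclic symmetry of this diagram, the choice of the crossing to be welded is immaterial. *)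

theory Defs
  imports "HOL-Algebra.Elementary_Groups" "HOL-Combinatorics.Orbits"
begin

section \<open>Virtual knot diagrams\<close>

text \<open>
  An oriented virtual knot diagram is recorded by the sequence of passages through its double
  points met while traversing the immersed circle once from a base point that is not a double
  point.  A passage stores the name of the double point, the role of the traversed branch there,
  and whether the other branch crosses the traversed one from its right to its left.  Since virtual
  crossings are recorded as well, including their local orientation, the sequence determines the
  immersed curve with its markings up to isotopy of the sphere.  Passing from the plane to
  the sphere does not affect welded equivalence: an edge of the diagram can be moved across
  infinity by virtual Reidemeister moves and planar isotopy, because it contains no crossing.
\<close>

datatype role = Over | Under | Virtual

datatype passage = Passage (crossing: nat) (role: role) (from_right: bool)

fun opposite :: "role \<Rightarrow> role" where
  "opposite Over = Under"
| "opposite Under = Over"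
| "opposite Virtual = Virtual"

text \<open>The passage along the other branch of the same double point.\<close>

definition partner :: "passage \<Rightarrow> passage" where
  "partner x = Passage (crossing x) (opposite (role x)) (\<not> from_right x)"

definition signed_gauss_code :: "passage list \<Rightarrow> bool" where
  "signed_gauss_code w \<longleftrightarrow>
     distinct w \<and> (\<forall>x\<in>set w. {y \<in> set w. crossing y = crossing x} = {x, partner x})"

definition position :: "passage list \<Rightarrow> passage \<Rightarrow> nat" where
  "position w x = (THE i. i < length w \<and> w ! i = x)"

text \<open>
  Edge \<open>i\<close> runs from the passage at position \<open>i\<close> to the cyclically next one.  The pair
  \<open>(i, True)\<close> is this edge with its orientation, \<open>(i, False)\<close> the edge traversed backwards.
  At the end of the edge, \<open>left_turn\<close> continues along the branch that leads to the left; its orbits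
  are the boundary cycles of the complementary regions, each region lying to the left.
\<close>

definition left_turn :: "passage list \<Rightarrow> nat \<times> bool \<Rightarrow> nat \<times> bool" where
  "left_turn w = (\<lambda>(i, forward).
     let m = length w;
         x = w ! (if forward then Suc i mod m else i);
         j = position w (partner x)
     in if from_right x = forward then (j, True) else ((j + m - 1) mod m, False))"

definition faces :: "passage list \<Rightarrow> (nat \<times> bool) set set" where
  "faces w = orbit (left_turn w) ` ({..<length w} \<times> UNIV)"

text \<open>
  Planarity is Euler's formula \<open>V - E + F = 2\<close>, with \<open>V = length w / 2\<close> double points and
  \<open>E = length w\<close> edges.  The empty code is the embedded circle.
\<close>

definition virtual_knot_diagram :: "passage list \<Rightarrow> bool" where
  "virtual_knot_diagram w \<longleftrightarrow>
     signed_gauss_code w \<and> (w = [] \<or> card (faces w) = length w div 2 + 2)"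


section \<open>Welded knots\<close>

text \<open>
  In the moves of Reidemeister type III three strands \<open>p q\<close>, \<open>r s\<close>, \<open>t z\<close> each contain two
  consecutive passages, and their three edges bound a triangle.  Let \<open>F = {p, r, t}\<close> be the set of
  the passages at which these edges start.  At the passage \<open>x\<close> the edge of the other branch points
  forward iff the partner of \<open>x\<close> is in \<open>F\<close>; hence the corner between the two edges lies to the left
  of the traversed edge iff \<open>corner_on_left F x\<close>.  The edges bound a triangular region iff, on
  each of them, both corners lie on the same side.
\<close>

definition corner_on_left :: "passage set \<Rightarrow> passage \<Rightarrow> bool" where
  "corner_on_left F x \<longleftrightarrow> (from_right x \<longleftrightarrow> (\<exists>y\<in>F. y \<noteq> x \<and> crossing y = crossing x))"

definition triangle ::
  "passage \<Rightarrow> passage \<Rightarrow> passage \<Rightarrow> passage \<Rightarrow> passage \<Rightarrow> passage \<Rightarrow> bool" where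
  "triangle p q r s t z \<longleftrightarrow>
     crossing p \<noteq> crossing q \<and> crossing r \<noteq> crossing s \<and> crossing t \<noteq> crossing z \<and>
     card (crossing ` {p, q, r, s, t, z}) = 3 \<and>
     (let F = {p, r, t} in
        corner_on_left F p = corner_on_left F q \<and>
        corner_on_left F r = corner_on_left F s \<and>
        corner_on_left F t = corner_on_left F z)"

text \<open>
  The first three rules identify codes of the same unoriented diagram: change of base point,
  reversal of the orientation (which leaves the \<open>from_right\<close> entries unchanged, as both branches
  are reversed), and renaming of the double points.  The other rules are the moves proper, written
  with a base point just before one of the strands involved.  In \<open>R3\<close>, \<open>vR3\<close>, \<open>vR4\<close>, \<open>Fo\<close> the
  strand \<open>p q\<close> is the one that slides over the crossing of the other two strands.  The codes
  related by a move are only required to be diagrams in the definition of \<open>welded_step\<close>.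
\<close>

inductive move :: "passage list \<Rightarrow> passage list \<Rightarrow> bool" where
  base_point: "move (u @ v) (v @ u)"
| reversal: "move w (rev w)"
| renaming: "inj_on f (crossing ` set w) \<Longrightarrow>
    move w (map (\<lambda>x. Passage (f (crossing x)) (role x) (from_right x)) w)"
| R1: "\<lbrakk>crossing x = crossing y; role x \<noteq> Virtual; role y \<noteq> Virtual\<rbrakk> \<Longrightarrow>
    move ([x, y] @ w) w"
| vR1: "\<lbrakk>crossing x = crossing y; role x = Virtual; role y = Virtual\<rbrakk> \<Longrightarrow>
    move ([x, y] @ w) w"
| R2: "\<lbrakk>crossing ` {p, q} = crossing ` {r, s}; from_right p \<noteq> from_right q;
        role p = Over; role q = Over; role r = Under; role s = Under\<rbrakk> \<Longrightarrow>
    move ([p, q] @ u @ [r, s] @ v) (u @ v)"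
| vR2: "\<lbrakk>crossing ` {p, q} = crossing ` {r, s}; from_right p \<noteq> from_right q;
         role ` {p, q, r, s} = {Virtual}\<rbrakk> \<Longrightarrow>
    move ([p, q] @ u @ [r, s] @ v) (u @ v)"
| R3: "\<lbrakk>triangle p q r s t z; role p = Over; role q = Over;
        role ` {p, q, r, s, t, z} = {Over, Under}\<rbrakk> \<Longrightarrow>
    move ([p, q] @ u @ [r, s] @ v @ [t, z] @ w) ([q, p] @ u @ [s, r] @ v @ [z, t] @ w)"
| vR3: "\<lbrakk>triangle p q r s t z; role ` {p, q, r, s, t, z} = {Virtual}\<rbrakk> \<Longrightarrow>
    move ([p, q] @ u @ [r, s] @ v @ [t, z] @ w) ([q, p] @ u @ [s, r] @ v @ [z, t] @ w)"
| vR4: "\<lbrakk>triangle p q r s t z; role p = Virtual; role q = Virtual;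
         role ` {p, q, r, s, t, z} = {Virtual, Over, Under}\<rbrakk> \<Longrightarrow>
    move ([p, q] @ u @ [r, s] @ v @ [t, z] @ w) ([q, p] @ u @ [s, r] @ v @ [z, t] @ w)"
| Fo: "\<lbrakk>triangle p q r s t z; role p = Over; role q = Over;
        role ` {p, q, r, s, t, z} = {Over, Under, Virtual}\<rbrakk> \<Longrightarrow>
    move ([p, q] @ u @ [r, s] @ v @ [t, z] @ w) ([q, p] @ u @ [s, r] @ v @ [z, t] @ w)"

definition welded_step :: "passage list \<Rightarrow> passage list \<Rightarrow> bool" where
  "welded_step v w \<longleftrightarrow> virtual_knot_diagram v \<and> virtual_knot_diagram w \<and> move v w"

text \<open>The welded knot represented by a diagram, as the set of codes of all its diagrams.\<close>

definition welded_knot :: "passage list \<Rightarrow> passage list set" where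
  "welded_knot w = {v. equivclp welded_step w v}"

definition weld :: "nat \<Rightarrow> passage list \<Rightarrow> passage list" where
  "weld c w = map (\<lambda>x. if crossing x = c then Passage c Virtual (from_right x) else x) w"

text \<open>
  The closure of the 2-braid \<open>\<sigma>\<^sub>1\<close> to the power \<open>2 n + 1\<close>, with crossings numbered along the
  braid.  In \<open>\<sigma>\<^sub>1\<close> the strand entering on the left is the over-strand, and the other strand crosses
  it from its right to its left.  As the strands change sides at every crossing and the exponent is
  odd, the knot runs through the braid twice, starting once in each of the two strands; the pass
  that starts on the left is on the left at the even-numbered crossings, the other pass at the
  odd-numbered ones.
\<close>

definition braid_pass :: "nat \<Rightarrow> bool \<Rightarrow> passage list" where
  "braid_pass m starts_left =
     map (\<lambda>i. if even i = starts_left then Passage i Over True else Passage i Under False) [0..<m]"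

definition torus_diagram :: "nat \<Rightarrow> passage list" where
  "torus_diagram n = braid_pass (2 * n + 1) True @ braid_pass (2 * n + 1) False"


section \<open>Groups given by generators and relations\<close>

text \<open>
  In a word, \<open>(x, True)\<close> stands for the generator \<open>x\<close> and \<open>(x, False)\<close> for its inverse.
  A relation is a pair of words which are to become equal.
\<close>

type_synonym 'g word = "('g \<times> bool) list"

inductive word_eq :: "'g set \<Rightarrow> ('g word \<times> 'g word) set \<Rightarrow> 'g word \<Rightarrow> 'g word \<Rightarrow> bool"
  for X R where
  refl: "word_eq X R u u"
| sym: "word_eq X R u v \<Longrightarrow> word_eq X R v u"
| trans: "word_eq X R u v \<Longrightarrow> word_eq X R v w \<Longrightarrow> word_eq X R u w"
| cancel: "x \<in> X \<Longrightarrow> word_eq X R (u @ [(x, b), (x, \<not> b)] @ v) (u @ v)"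
| relation: "(l, r) \<in> R \<Longrightarrow> word_eq X R (u @ l @ v) (u @ r @ v)"

definition word_class :: "'g set \<Rightarrow> ('g word \<times> 'g word) set \<Rightarrow> 'g word \<Rightarrow> 'g word set" where
  "word_class X R u = {v \<in> lists (X \<times> UNIV). word_eq X R u v}"

definition presented_group :: "'g set \<Rightarrow> ('g word \<times> 'g word) set \<Rightarrow> 'g word set monoid" where
  "presented_group X R =
     \<lparr>carrier = word_class X R ` lists (X \<times> UNIV),
      monoid.mult = (\<lambda>A B. \<Union>a\<in>A. \<Union>b\<in>B. word_class X R (a @ b)),
      monoid.one = word_class X R []\<rparr>"


section \<open>The group of a diagram\<close>

definition under_passages :: "passage list \<Rightarrow> nat" where
  "under_passages w = length (filter (\<lambda>x. role x = Under) w)"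

text \<open>
  The arcs are numbered cyclically, the number increasing by one at each under-passage;
  \<open>arc w i\<close> is the arc that arrives at position \<open>i\<close>, so \<open>arc w (Suc i)\<close> is the one that leaves it.
  A diagram without classical crossings has the single arc \<open>0\<close>, because \<open>0 mod 0 = 0\<close>.
\<close>

definition arc :: "passage list \<Rightarrow> nat \<Rightarrow> nat" where
  "arc w i = under_passages (take i w) mod under_passages w"

definition arcs :: "passage list \<Rightarrow> nat set" where
  "arcs w = arc w ` {..length w}"

text \<open>
  At a classical crossing with over-passage at position \<open>i\<close> and under-passage at position \<open>j\<close>, the
  under-arc on the right of the over-arc is the arriving one iff the lower branch crosses from right
  to left.
\<close>

definition wirtinger_relations :: "passage list \<Rightarrow> (nat word \<times> nat word) set" where
  "wirtinger_relations w =
     {(l, r). \<exists>i j y x\<^sub>l x\<^sub>r.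
        i < length w \<and> j < length w \<and> role (w ! i) = Over \<and> w ! j = partner (w ! i) \<and>
        y = arc w i \<and>
        x\<^sub>r = (if from_right (w ! i) then arc w j else arc w (Suc j)) \<and>
        x\<^sub>l = (if from_right (w ! i) then arc w (Suc j) else arc w j) \<and>
        l = [(x\<^sub>l, True)] \<and> r = [(y, True), (x\<^sub>r, True), (y, False)]}"

definition knot_group :: "passage list \<Rightarrow> nat word set monoid" where
  "knot_group w = presented_group (arcs w) (wirtinger_relations w)"

end

theory Submission
  imports Defs
begin

text \<open>
  Instead of constructing isomorphisms between the groups of related diagrams, we colour the edges of
  a diagram by the elements of arbitrary quandles.  The property that, in every quandle of a given
  type, all colourings are constant is invariant under all the moves.  For the welded torus diagram,
  the operators of the two strand colours commute because the product of the two operators at a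
  level of the braid is changed by no classical crossing, while the welded crossing swaps its
  factors; this forces the two colours to agree.  Finally the arcs of a diagram define a colouring in
  the conjugation quandle of its Wirtinger group.  If it is constant, the group is generated by one
  element, which has infinite order by counting exponents.
\<close>

section \<open>Quandle colourings\<close>

text \<open>Colours sit on edges rather than arcs, so a move only has to preserve the colours at the
  ends of the strands it touches, and no arcs need renumbering. In a group, a braid conserves the
  product of the two strand colours, the class of a loop around both strands. A quandle has no such
  product; the composite of the two operators takes its place. The argument therefore yields
  commutation of operators only, not of colours, and idempotence has to turn equal operators into
  equal colours at the end. The quandle type can be fixed once and for all: arcs are natural numbers
  in every diagram, so all Wirtinger groups live on the single type
  \<open>nat word set\<close>.\<close>

locale quandle =
  fixes f g :: "'a \<Rightarrow> 'a \<Rightarrow> 'a"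
  assumes idem [simp]: "f a a = a"
    and g_f [simp]: "g a (f a b) = b"
    and f_g [simp]: "f a (g a b) = b"
    and f_f: "f a (f b c) = f (f a b) (f a c)"
begin

lemma g_idem [simp]: "g a a = a"
  using g_f[of a a] by simp

lemma f_inject [simp]: "f a b = f a c \<longleftrightarrow> b = c"
  by (metis g_f)

lemma g_inject [simp]: "g a b = g a c \<longleftrightarrow> b = c"
  by (metis f_g)

lemma f_eq_left [simp]: "f a b = a \<longleftrightarrow> b = a"
  using f_inject[of a b a] by simp

lemma g_eq_left [simp]: "g a b = a \<longleftrightarrow> b = a"
  using g_inject[of a b a] by simp

lemma eq_f_left [simp]: "a = f a b \<longleftrightarrow> b = a"
  by (metis f_eq_left)

lemma eq_g_left [simp]: "a = g a b \<longleftrightarrow> b = a"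
  by (metis g_eq_left)

lemma f_dist_g: "f a (g b c) = g (f a b) (f a c)"
  by (metis f_f f_g g_f)

lemma g_dist_f: "g a (f b c) = f (g a b) (g a c)"
  by (metis f_f f_g g_f)

lemma g_dist_g: "g a (g b c) = g (g a b) (g a c)"
  by (metis g_dist_f f_g g_f)

lemma dual: "quandle g f"
  by unfold_locales (simp, simp, simp, rule g_dist_g)

text \<open>Each operator is an automorphism, so the operator of an image is the conjugate of the
  operator. Used as rewrite rules, these equations remove operators whose index is a compound
  colour.\<close>

lemma act_by_image:
  "f (f a b) c = f a (f b (g a c))" "g (f a b) c = f a (g b (g a c))"
  "f (g a b) c = g a (f b (f a c))" "g (g a b) c = g a (g b (f a c))"
  by (simp add: f_f[of a b "g a c"], simp add: f_dist_g[of a b "g a c"],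
      simp add: g_dist_f[of a b "f a c"], simp add: g_dist_g[of a b "f a c"])

end

text \<open>\<open>f\<close> stands for conjugation by the over-colour. If \<open>from_right\<close>
  holds at an under-passage, the over-branch crosses it from right to left, so the under-branch
  itself runs from the left of the over-arc to its right and is conjugated by the inverse, which is
  \<open>g\<close>.\<close>

definition pass :: "('a \<Rightarrow> 'a \<Rightarrow> 'a) \<Rightarrow> ('a \<Rightarrow> 'a \<Rightarrow> 'a) \<Rightarrow> (nat \<Rightarrow> 'a) \<Rightarrow> passage \<Rightarrow> 'a \<Rightarrow> 'a" where
  "pass f g k x a =
     (if role x = Under then (if from_right x then g else f) (k (crossing x)) a else a)"

text \<open>
  Here \<open>k\<close> gives the colour of the over-arc at each crossing; \<open>a\<close> and \<open>b\<close> are the colours of the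
  edges entering and leaving the strand.
\<close>

fun colors ::
  "('a \<Rightarrow> 'a \<Rightarrow> 'a) \<Rightarrow> ('a \<Rightarrow> 'a \<Rightarrow> 'a) \<Rightarrow> (nat \<Rightarrow> 'a) \<Rightarrow> 'a \<Rightarrow> passage list \<Rightarrow> 'a \<Rightarrow> bool" where
  "colors f g k a [] b \<longleftrightarrow> a = b"
| "colors f g k a (x # w) b \<longleftrightarrow>
     (role x = Over \<longrightarrow> k (crossing x) = a) \<and> colors f g k (pass f g k x a) w b"

text \<open>Constancy is tested at over-passages only. Colours change only at under-passages,
  through \<open>k\<close>, so in a Gauss code the remaining edges follow.\<close>

definition mono_over :: "(nat \<Rightarrow> 'a) \<Rightarrow> 'a \<Rightarrow> passage list \<Rightarrow> bool" where
  "mono_over k a w \<longleftrightarrow> (\<forall>x\<in>set w. role x = Over \<longrightarrow> k (crossing x) = a)"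

definition rigid :: "('a \<Rightarrow> 'a \<Rightarrow> 'a) \<Rightarrow> ('a \<Rightarrow> 'a \<Rightarrow> 'a) \<Rightarrow> passage list \<Rightarrow> bool" where
  "rigid f g w \<longleftrightarrow> (\<forall>k a. colors f g k a w a \<longrightarrow> mono_over k a w)"

lemma rigidI:
  assumes "\<And>k a. colors f g k a w a \<Longrightarrow>
      \<exists>k' a'. colors f g k' a' v a' \<and> (mono_over k' a' v \<longrightarrow> mono_over k a w)"
    and "rigid f g v"
  shows "rigid f g w"
  using assms unfolding rigid_def by blast

lemma colors_append:
  "colors f g k a (u @ v) b \<longleftrightarrow> (\<exists>m. colors f g k a u m \<and> colors f g k m v b)"
  by (induction u arbitrary: a) auto

lemma colors_cong:
  "(\<And>x. x \<in> set w \<Longrightarrow> k (crossing x) = k' (crossing x)) \<Longrightarrow>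
     colors f g k a w b \<longleftrightarrow> colors f g k' a w b"
  by (induction w arbitrary: a) (auto simp: pass_def)

lemma mono_over_simps [simp]:
  "mono_over k a []"
  "mono_over k a (x # w) \<longleftrightarrow> (role x = Over \<longrightarrow> k (crossing x) = a) \<and> mono_over k a w"
  "mono_over k a (u @ v) \<longleftrightarrow> mono_over k a u \<and> mono_over k a v"
  by (auto simp: mono_over_def)

lemma mono_over_cong:
  "(\<And>x. x \<in> set w \<Longrightarrow> k (crossing x) = k' (crossing x)) \<Longrightarrow> mono_over k a w \<longleftrightarrow> mono_over k' a w"
  by (auto simp: mono_over_def)

lemma mono_over_subset: "mono_over k a w \<Longrightarrow> set v \<subseteq> set w \<Longrightarrow> mono_over k a v"
  by (auto simp: mono_over_def)

lemma partner_simps [simp]: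
  "crossing (partner x) = crossing x"
  "role (partner x) = opposite (role x)"
  "from_right (partner x) \<longleftrightarrow> \<not> from_right x"
  "partner (partner x) = x"
  "partner x \<noteq> x"
  by (cases x; cases "role x"; simp add: partner_def)+

lemma opposite_simps [simp]:
  "opposite r = Under \<longleftrightarrow> r = Over"
  "opposite r = Over \<longleftrightarrow> r = Under"
  "opposite r = Virtual \<longleftrightarrow> r = Virtual"
  by (cases r; simp)+

lemma partner_in_code: "signed_gauss_code w \<Longrightarrow> x \<in> set w \<Longrightarrow> partner x \<in> set w"
  unfolding signed_gauss_code_def by blast

lemma same_crossing:
  "signed_gauss_code w \<Longrightarrow> x \<in> set w \<Longrightarrow> y \<in> set w \<Longrightarrow> crossing y = crossing x \<Longrightarrow>
     y = x \<or> y = partner x"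
  unfolding signed_gauss_code_def by blast

lemma code_distinct: "signed_gauss_code w \<Longrightarrow> distinct w"
  unfolding signed_gauss_code_def by blast

text \<open>At an under-passage the partner over-passage also lies in the code, so the acting colour
  is \<open>a\<close>, and idempotence makes it fix \<open>a\<close>. Since \<open>u\<close> may be
  any piece of the code, this reaches intermediate edges too.\<close>

lemma (in quandle) colors_mono:
  assumes "signed_gauss_code w" "mono_over k a w" "set u \<subseteq> set w" "colors f g k a u b"
  shows "b = a"
  using assms(3,4)
proof (induction u)
  case (Cons x u)
  have "k (crossing x) = a" if "role x = Under"
  proof -
    have "partner x \<in> set w"
      using partner_in_code[OF assms(1)] Cons.prems(1) by simp
    then have "k (crossing (partner x)) = a"
      using assms(2) that unfolding mono_over_def by (simp del: partner_simps(1))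
    then show ?thesis by simp
  qed
  then have "pass f g k x a = a"
    by (simp add: pass_def)
  then have "colors f g k a u b"
    using Cons.prems(2) by simp
  then show ?case
    using Cons.IH Cons.prems(1) by simp
qed simp


section \<open>Invariance under the moves\<close>

lemma (in quandle) rigid_base_point:
  assumes "signed_gauss_code (u @ v)" "rigid f g (u @ v)"
  shows "rigid f g (v @ u)"
  unfolding rigid_def
proof (intro allI impI)
  fix k a assume "colors f g k a (v @ u) a"
  then obtain b where b: "colors f g k a v b" "colors f g k b u a"
    unfolding colors_append by blast
  then have "colors f g k b (u @ v) b"
    unfolding colors_append by blast
  then have m: "mono_over k b (u @ v)"
    using assms(2) unfolding rigid_def by blast
  \<comment> \<open>Rigidity gives the constant value \<open>b\<close> at the other base point; it
    still has to be carried along \<open>u\<close>.\<close>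
  then have "a = b"
    using colors_mono[OF assms(1) m _ b(2)] by simp
  then show "mono_over k a (v @ u)"
    using m by simp
qed

lemma (in quandle) pass_inverse: "pass g f k x b = a \<longleftrightarrow> b = pass f g k x a"
  by (auto simp: pass_def)

lemma (in quandle) pass_over: "role x = Over \<Longrightarrow> pass f g k x a = a"
  by (simp add: pass_def)

text \<open>Traversed backwards, a passage applies the inverse operator while its
  \<open>from_right\<close> entry stays the same; exchanging \<open>f\<close> and \<open>g\<close>
  compensates. Over-passages read the same colour from either side.\<close>

lemma (in quandle) colors_rev:
  "colors g f k b (rev w) a \<longleftrightarrow> colors f g k a w b"
proof (induction w arbitrary: a)
  case (Cons x w)
  have "colors g f k b (rev (x # w)) a \<longleftrightarrow>
      (\<exists>m. colors f g k m w b \<and> (role x = Over \<longrightarrow> k (crossing x) = m) \<and> m = pass f g k x a)"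
    by (simp add: colors_append Cons.IH pass_inverse)
  then show ?case
    by (auto simp: pass_over)
qed auto

lemma (in quandle) rigid_reversal: "rigid g f (rev w) \<longleftrightarrow> rigid f g w"
  by (simp add: rigid_def colors_rev mono_over_def)

abbreviation rename :: "(nat \<Rightarrow> nat) \<Rightarrow> passage list \<Rightarrow> passage list" where
  "rename h w \<equiv> map (\<lambda>x. Passage (h (crossing x)) (role x) (from_right x)) w"

lemma colors_rename: "colors f g k a (rename h w) b \<longleftrightarrow> colors f g (k \<circ> h) a w b"
  by (induction w arbitrary: a) (auto simp: pass_def)

lemma mono_over_rename: "mono_over k a (rename h w) \<longleftrightarrow> mono_over (k \<circ> h) a w"
  by (auto simp: mono_over_def)

lemma rigid_rename:
  assumes "inj_on h (crossing ` set w)"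
  shows "rigid f g (rename h w) \<longleftrightarrow> rigid f g w"
proof
  assume R: "rigid f g (rename h w)"
  show "rigid f g w"
  proof (rule rigidI[OF _ R])
    fix k a assume c: "colors f g k a w a"
    let ?k = "k \<circ> inv_into (crossing ` set w) h"
    have eq: "(?k \<circ> h) (crossing x) = k (crossing x)" if "x \<in> set w" for x
      using that assms by simp
    have "colors f g ?k a (rename h w) a"
      unfolding colors_rename using c colors_cong[of w "?k \<circ> h" k] eq by blast
    moreover have "mono_over ?k a (rename h w) \<longrightarrow> mono_over k a w"
      unfolding mono_over_rename using mono_over_cong[of w "?k \<circ> h" k] eq by blast
    ultimately show "\<exists>k' a'. colors f g k' a' (rename h w) a' \<and>
        (mono_over k' a' (rename h w) \<longrightarrow> mono_over k a w)" by blast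
  qed
next
  show "rigid f g w \<Longrightarrow> rigid f g (rename h w)"
    by (auto simp: rigid_def colors_rename mono_over_rename)
qed

section \<open>Moves of types I and II\<close>

lemma (in quandle) rigid_R1:
  assumes code: "signed_gauss_code ([x, y] @ w)" and "crossing x = crossing y" "role x \<noteq> Virtual"
  shows "rigid f g ([x, y] @ w) \<longleftrightarrow> rigid f g w"
proof -
  have y: "y = partner x"
    using same_crossing[OF code, of x y] code_distinct[OF code] assms(2) by auto
  have new: "crossing z \<noteq> crossing x" if "z \<in> set w" for z
    using same_crossing[OF code, of x z] code_distinct[OF code] that y by auto
  \<comment> \<open>If the under-passage comes first, the loop has a colour \<open>c\<close> with
    \<open>f c a = c\<close> or \<open>g c a = c\<close>, which forces \<open>a = c\<close>;
    otherwise \<open>a\<close> acts on itself. Both cases rest on idempotence.\<close>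
  have loop: "colors f g k a [x, y] b \<longleftrightarrow> b = a \<and> k (crossing x) = a" for k a b
    using assms(3) by (cases "role x") (auto simp: y pass_def)
  show ?thesis
  proof
    assume R: "rigid f g ([x, y] @ w)"
    show "rigid f g w"
    proof (rule rigidI[OF _ R])
      fix k a assume c: "colors f g k a w a"
      \<comment> \<open>The crossing of the kink is absent from \<open>w\<close>, so its value is
        free and is set to the colour that the kink carries.\<close>
      let ?k = "k(crossing x := a)"
      have "colors f g ?k a ([x, y] @ w) a"
        using colors_cong[of w ?k k] new c unfolding colors_append loop by auto
      moreover have "mono_over ?k a ([x, y] @ w) \<longrightarrow> mono_over k a w"
        using mono_over_cong[of w ?k k] new by auto
      ultimately show "\<exists>k' a'. colors f g k' a' ([x, y] @ w) a' \<and>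
          (mono_over k' a' ([x, y] @ w) \<longrightarrow> mono_over k a w)" by blast
    qed
  next
    assume R: "rigid f g w"
    show "rigid f g ([x, y] @ w)"
    proof (rule rigidI[OF _ R])
      fix k a assume "colors f g k a ([x, y] @ w) a"
      then have "colors f g k a w a" "k (crossing x) = a"
        unfolding colors_append loop by auto
      then show "\<exists>k' a'. colors f g k' a' w a' \<and>
          (mono_over k' a' w \<longrightarrow> mono_over k a ([x, y] @ w))"
        by (intro exI[of _ k] exI[of _ a]) (use assms(2) in auto)
    qed
  qed
qed

lemma (in quandle) rigid_vR1:
  assumes "role x = Virtual" "role y = Virtual"
  shows "rigid f g ([x, y] @ w) \<longleftrightarrow> rigid f g w"
  using assms by (simp add: rigid_def pass_def)

text \<open>The lower strand meets the same over-colour \<open>a\<close> twice with opposite signs,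
  so \<open>f a\<close> and \<open>g a\<close> cancel, whichever of the two crossings it reaches
  first.\<close>

lemma (in quandle) rigid_R2:
  assumes code: "signed_gauss_code ([p, q] @ u @ [r, s] @ v)"
    and cr: "crossing ` {p, q} = crossing ` {r, s}"
    and "from_right p \<noteq> from_right q"
    and roles: "role p = Over" "role q = Over" "role r = Under" "role s = Under"
  shows "rigid f g ([p, q] @ u @ [r, s] @ v) \<longleftrightarrow> rigid f g (u @ v)"
proof -
  let ?w = "[p, q] @ u @ [r, s] @ v"
  have "crossing p \<noteq> crossing q"
    using same_crossing[OF code, of p q] assms(3) roles by auto
  moreover have *: "y = partner x" if "x \<in> {p, q}" "y \<in> {r, s}" "crossing x = crossing y" for x y
    using same_crossing[OF code, of x y] that roles by auto
  moreover have "crossing r \<in> {crossing p, crossing q}" "crossing s \<in> {crossing p, crossing q}"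
    "crossing p \<in> {crossing r, crossing s}" "crossing q \<in> {crossing r, crossing s}"
    using cr by auto
  ultimately have rs: "r = partner p \<and> s = partner q \<or> r = partner q \<and> s = partner p"
    by (smt (verit, best) insert_iff empty_iff)
  have new: "crossing z \<notin> {crossing p, crossing q}" if "z \<in> set (u @ v)" for z
    using same_crossing[OF code, of p z] same_crossing[OF code, of q z] code_distinct[OF code] that rs
    by auto
  have top: "colors f g k a [p, q] b \<longleftrightarrow> b = a \<and> k (crossing p) = a \<and> k (crossing q) = a" for k a b
    using roles by (auto simp: pass_def)
  have bottom: "colors f g k c [r, s] b \<longleftrightarrow> b = c"
    if "k (crossing p) = a" "k (crossing q) = a" for k a b c
    using rs that roles assms(3) by (auto simp: pass_def)
  show ?thesis
  proof
    assume R: "rigid f g ?w"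
    show "rigid f g (u @ v)"
    proof (rule rigidI[OF _ R])
      fix k a assume "colors f g k a (u @ v) a"
      then obtain m where m: "colors f g k a u m" "colors f g k m v a"
        by (auto simp: colors_append)
      let ?k = "k(crossing p := a, crossing q := a)"
      have "colors f g ?k a u m" "colors f g ?k m v a"
        using colors_cong[of u ?k k] colors_cong[of v ?k k] new m by auto
      moreover have "colors f g ?k a [p, q] a" "colors f g ?k m [r, s] m"
        by (simp only: top, simp) (subst bottom[of ?k a], simp_all)
      ultimately have "colors f g ?k a ?w a"
        unfolding colors_append by blast
      moreover have "mono_over ?k a (u @ v) \<longleftrightarrow> mono_over k a (u @ v)"
        by (rule mono_over_cong) (use new in auto)
      then have "mono_over ?k a ?w \<longrightarrow> mono_over k a (u @ v)"
        using mono_over_subset[of ?k a ?w "u @ v"] by auto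
      ultimately show "\<exists>k' a'. colors f g k' a' ?w a' \<and>
          (mono_over k' a' ?w \<longrightarrow> mono_over k a (u @ v))" by blast
    qed
  next
    assume R: "rigid f g (u @ v)"
    show "rigid f g ?w"
    proof (rule rigidI[OF _ R])
      fix k a assume "colors f g k a ?w a"
      then obtain m1 m2 m3 where m: "colors f g k a [p, q] m1" "colors f g k m1 u m2"
          "colors f g k m2 [r, s] m3" "colors f g k m3 v a"
        unfolding colors_append by blast
      from m(1) have "m1 = a" and k: "k (crossing p) = a" "k (crossing q) = a"
        unfolding top by auto
      moreover have "m3 = m2"
        using m(3) unfolding bottom[OF k] .
      ultimately have "colors f g k a (u @ v) a"
        using m by (auto simp: colors_append)
      then show "\<exists>k' a'. colors f g k' a' (u @ v) a' \<and>
          (mono_over k' a' (u @ v) \<longrightarrow> mono_over k a ?w)"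
        by (intro exI[of _ k] exI[of _ a]) (use k roles in auto)
    qed
  qed
qed

lemma (in quandle) rigid_vR2:
  assumes "role ` {p, q, r, s} = {Virtual}"
  shows "rigid f g ([p, q] @ u @ [r, s] @ v) \<longleftrightarrow> rigid f g (u @ v)"
proof -
  have "role p = Virtual" "role q = Virtual" "role r = Virtual" "role s = Virtual"
    using assms by auto
  then have "colors f g k a ([p, q] @ u @ [r, s] @ v) b \<longleftrightarrow> colors f g k a (u @ v) b"
    and "mono_over k a ([p, q] @ u @ [r, s] @ v) \<longleftrightarrow> mono_over k a (u @ v)" for k a b
    by (simp_all add: pass_def colors_append)
  then show ?thesis
    unfolding rigid_def by (simp only:)
qed

section \<open>Moves of type III\<close>

text \<open>Local invariance: the three strands are recoloured with their end colours kept, so the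
  rest of the diagram is unaffected. The last clause pulls constancy back, as \<open>rigidI\<close>
  demands.\<close>

definition slides ::
  "('a \<Rightarrow> 'a \<Rightarrow> 'a) \<Rightarrow> ('a \<Rightarrow> 'a \<Rightarrow> 'a) \<Rightarrow> passage \<Rightarrow> passage \<Rightarrow> passage \<Rightarrow> passage \<Rightarrow>
    passage \<Rightarrow> passage \<Rightarrow> bool" where
  "slides f g p q r s t z \<longleftrightarrow>
     (\<forall>k a a' b b' d d'.
        colors f g k a [p, q] a' \<and> colors f g k b [r, s] b' \<and> colors f g k d [t, z] d' \<longrightarrow>
        (\<exists>k'. (\<forall>i. i \<notin> crossing ` {p, q, r, s, t, z} \<longrightarrow> k' i = k i) \<and>
           colors f g k' a [q, p] a' \<and> colors f g k' b [s, r] b' \<and> colors f g k' d [z, t] d' \<and>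
           (\<forall>e. mono_over k' e [q, p, s, r, z, t] \<longrightarrow> mono_over k e [p, q, r, s, t, z])))"

text \<open>Double counting: at every crossing met by \<open>S\<close>, the union of
  \<open>S\<close> with its partners has exactly two passages. If \<open>S\<close> already has two
  per crossing on average, the partners add nothing.\<close>

lemma closed_under_partner:
  assumes code: "signed_gauss_code w" and sub: "S \<subseteq> set w"
    and card: "card S = 2 * card (crossing ` S)" and "x \<in> S"
  shows "partner x \<in> S"
proof -
  let ?T = "S \<union> partner ` S"
  have fin: "finite S"
    using sub finite_subset by blast
  have T: "?T \<subseteq> set w"
    using sub partner_in_code[OF code] by auto
  have "card ?T = (\<Sum>c\<in>crossing ` ?T. card {x \<in> ?T. crossing x = c})"
    unfolding card_eq_sum by (rule sum.image_gen) (use fin in blast)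
  also have "\<dots> = (\<Sum>c\<in>crossing ` ?T. 2)"
  proof (rule sum.cong)
    fix c assume "c \<in> crossing ` ?T"
    then obtain y where y: "y \<in> S" "c = crossing y"
      by auto
    have "{x \<in> ?T. crossing x = c} = {y, partner y}"
      using same_crossing[OF code, of y] T y by auto
    then show "card {x \<in> ?T. crossing x = c} = 2"
      by (simp add: eq_commute[of y])
  qed simp
  also have "crossing ` ?T = crossing ` S"
    by (auto simp: image_Un image_image)
  finally have "card ?T = card S"
    using card by simp
  then have "S = ?T"
    using fin by (intro card_subset_eq) auto
  then show ?thesis
    using \<open>x \<in> S\<close> by blast
qed

lemma triangle_partners:
  assumes code: "signed_gauss_code ([p, q] @ u @ [r, s] @ v @ [t, z] @ w)"
    and tri: "triangle p q r s t z"
  shows "\<forall>x\<in>{p, q, r, s, t, z}. partner x \<in> {p, q, r, s, t, z}"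
    and "\<And>x. x \<in> set (u @ v @ w) \<Longrightarrow> crossing x \<notin> crossing ` {p, q, r, s, t, z}"
proof -
  let ?S = "{p, q, r, s, t, z}" and ?w = "[p, q] @ u @ [r, s] @ v @ [t, z] @ w"
  have sub: "?S \<subseteq> set ?w"
    by auto
  have "card ?S = 6"
    using code_distinct[OF code] by auto
  then have card: "card ?S = 2 * card (crossing ` ?S)"
    using tri unfolding triangle_def by simp
  show cl: "\<forall>x\<in>?S. partner x \<in> ?S"
    using closed_under_partner[OF code sub card] by blast
  fix x assume x: "x \<in> set (u @ v @ w)"
  then have "x \<notin> ?S" "x \<in> set ?w"
    using code_distinct[OF code] by auto
  moreover have "x \<in> ?S" if "crossing x = crossing y" "y \<in> ?S" for y
    using same_crossing[OF code, of y x] that \<open>x \<in> set ?w\<close> sub cl by blast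
  ultimately show "crossing x \<notin> crossing ` ?S"
    by blast
qed

text \<open>Up to the order on the lower strands there is one shape: \<open>p\<close> crosses one of
  them, \<open>q\<close> the other, and the leftover passages \<open>x'\<close> and
  \<open>y'\<close> form the crossing of the lower strands with each other.\<close>

lemma triangle_pairing:
  assumes cl: "\<forall>x\<in>{p, q, r, s, t, z}. partner x \<in> {p, q, r, s, t, z}"
    and dist: "distinct [p, q, r, s, t, z]"
    and tri: "triangle p q r s t z"
    and p: "partner p \<in> {r, s}"
  obtains x' y' where "(partner p, x') \<in> {(r, s), (s, r)}" "(partner q, y') \<in> {(t, z), (z, t)}"
    "y' = partner x'"
    "crossing p \<noteq> crossing q" "crossing x' \<noteq> crossing p" "crossing x' \<noteq> crossing q"
proof -
  have ne: "crossing p \<noteq> crossing q" "crossing r \<noteq> crossing s" "crossing t \<noteq> crossing z"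
    using tri by (auto simp: triangle_def)
  have inv: "partner a = b \<longleftrightarrow> a = partner b" for a b
    by (metis partner_simps(4))
  have diff: "crossing a = crossing b" if "partner a = b" for a b
    using that by auto
  \<comment> \<open>Otherwise \<open>p\<close>, \<open>q\<close>, \<open>r\<close>, \<open>s\<close>
    would be paired among themselves, leaving \<open>t\<close> and \<open>z\<close> at a common
    crossing, which \<open>triangle\<close> excludes.\<close>
  have "partner q \<notin> {r, s}"
  proof
    assume q: "partner q \<in> {r, s}"
    have "partner p \<noteq> partner q"
      using ne(1) by (metis partner_simps(1))
    then have rs: "{r, s} = {partner p, partner q}"
      using p q by auto
    have "partner t \<in> {p, q, r, s}"
      using cl ne(3) diff[of t z] by (metis insertE insertI1 insert_commute partner_simps(5) singletonD)
    then have "partner t \<in> {p, q} \<or> partner t \<in> {partner p, partner q}"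
      unfolding rs[symmetric] by auto
    then have "t \<in> {partner p, partner q, p, q}"
      using inv by auto
    then have "t \<in> {r, s, p, q}"
      using rs by auto
    then show False
      using dist by auto
  qed
  then have q: "partner q \<in> {t, z}"
    using cl ne(1) diff[of q p] by (metis insertE insertI1 insert_commute partner_simps(5) singletonD)
  define x' where "x' = (if partner p = r then s else r)"
  define y' where "y' = (if partner q = t then z else t)"
  have x: "(partner p, x') \<in> {(r, s), (s, r)}" and y: "(partner q, y') \<in> {(t, z), (z, t)}"
    using p q by (auto simp: x'_def y'_def)
  have S: "{p, q, r, s, t, z} = {p, q, partner p, partner q, x', y'}"
    and D: "distinct [p, q, partner p, partner q, x', y']"
    using x y dist by auto
  have "partner x' \<in> {p, q, partner p, partner q, x', y'}"
    using cl unfolding S by blast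
  then have y': "y' = partner x'"
    using D inv by auto
  have "crossing ` {p, q, r, s, t, z} = {crossing p, crossing q, crossing x'}"
    unfolding S using y' by auto
  then have "card {crossing p, crossing q, crossing x'} = 3"
    using tri unfolding triangle_def by simp
  then have "crossing x' \<noteq> crossing p" "crossing x' \<noteq> crossing q"
    by (auto simp: card_insert_if split: if_splits)
  then show thesis
    using that x y y' ne(1) by blast
qed

text \<open>The lower strands play symmetric parts; this reduces matters to the case that
  \<open>p\<close> crosses the strand \<open>r s\<close>.\<close>

lemma slides_swap: "slides f g p q t z r s \<Longrightarrow> slides f g p q r s t z"
  unfolding slides_def
proof (intro allI impI)
  assume H: "\<forall>k a a' b b' d d'.
        colors f g k a [p, q] a' \<and> colors f g k b [t, z] b' \<and> colors f g k d [r, s] d' \<longrightarrow>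
        (\<exists>k'. (\<forall>i. i \<notin> crossing ` {p, q, t, z, r, s} \<longrightarrow> k' i = k i) \<and>
           colors f g k' a [q, p] a' \<and> colors f g k' b [z, t] b' \<and> colors f g k' d [s, r] d' \<and>
           (\<forall>e. mono_over k' e [q, p, z, t, s, r] \<longrightarrow> mono_over k e [p, q, t, z, r, s]))"
  fix k a a' b b' d d'
  assume "colors f g k a [p, q] a' \<and> colors f g k b [r, s] b' \<and> colors f g k d [t, z] d'"
  then have "colors f g k a [p, q] a' \<and> colors f g k d [t, z] d' \<and> colors f g k b [r, s] b'"
    by blast
  from H[rule_format, OF this] obtain k' where
    k': "\<forall>i. i \<notin> crossing ` {p, q, t, z, r, s} \<longrightarrow> k' i = k i"
      "colors f g k' a [q, p] a'" "colors f g k' d [z, t] d'" "colors f g k' b [s, r] b'"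
      "\<forall>e. mono_over k' e [q, p, z, t, s, r] \<longrightarrow> mono_over k e [p, q, t, z, r, s]"
    by blast
  have "mono_over k' e [q, p, s, r, z, t] \<longleftrightarrow> mono_over k' e [q, p, z, t, s, r]"
    and "mono_over k e [p, q, r, s, t, z] \<longleftrightarrow> mono_over k e [p, q, t, z, r, s]" for e
    by (auto simp: mono_over_def)
  moreover have "{p, q, t, z, r, s} = {p, q, r, s, t, z}"
    by auto
  ultimately show "\<exists>k'. (\<forall>i. i \<notin> crossing ` {p, q, r, s, t, z} \<longrightarrow> k' i = k i) \<and>
      colors f g k' a [q, p] a' \<and> colors f g k' b [s, r] b' \<and> colors f g k' d [z, t] d' \<and>
      (\<forall>e. mono_over k' e [q, p, s, r, z, t] \<longrightarrow> mono_over k e [p, q, r, s, t, z])"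
    using k' by (intro exI[of _ k']) (simp only: simp_thms)
qed

lemma colors_virtual_swap:
  "role x = Virtual \<or> role y = Virtual \<Longrightarrow> colors f g k a [x, y] b \<longleftrightarrow> colors f g k a [y, x] b"
  by (auto simp: pass_def)

lemma colors_over_swap:
  "role x = Over \<Longrightarrow> role y = Over \<Longrightarrow> colors f g k a [x, y] b \<longleftrightarrow> colors f g k a [y, x] b"
  by (auto simp: pass_def)

lemma slides_commuting:
  assumes "\<And>k a b. colors f g k a [p, q] b \<Longrightarrow> colors f g k a [q, p] b"
    "\<And>k a b. colors f g k a [r, s] b \<Longrightarrow> colors f g k a [s, r] b"
    "\<And>k a b. colors f g k a [t, z] b \<Longrightarrow> colors f g k a [z, t] b"
  shows "slides f g p q r s t z"
  unfolding slides_def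
proof (intro allI impI)
  fix k a a' b b' d d'
  assume "colors f g k a [p, q] a' \<and> colors f g k b [r, s] b' \<and> colors f g k d [t, z] d'"
  then have "colors f g k a [q, p] a' \<and> colors f g k b [s, r] b' \<and> colors f g k d [z, t] d'"
    using assms by blast
  moreover have "\<forall>e. mono_over k e [q, p, s, r, z, t] \<longrightarrow> mono_over k e [p, q, r, s, t, z]"
    by simp
  ultimately show "\<exists>k'. (\<forall>i. i \<notin> crossing ` {p, q, r, s, t, z} \<longrightarrow> k' i = k i) \<and>
      colors f g k' a [q, p] a' \<and> colors f g k' b [s, r] b' \<and> colors f g k' d [z, t] d' \<and>
      (\<forall>e. mono_over k' e [q, p, s, r, z, t] \<longrightarrow> mono_over k e [p, q, r, s, t, z])"
    by blast
qed

text \<open>Makes the inverse of a slide a slide again. Reversing the three strands replaces the set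
  of starting passages by its complement among the six, so every \<open>corner_on_left\<close> is
  negated and the equalities along the edges persist.\<close>

lemma triangle_flip:
  assumes code: "signed_gauss_code ([p, q] @ u @ [r, s] @ v @ [t, z] @ w)"
    and tri: "triangle p q r s t z"
  shows "triangle q p s r z t"
proof -
  let ?S = "{p, q, r, s, t, z}" and ?F = "{p, r, t}" and ?F' = "{q, s, z}"
    and ?w = "[p, q] @ u @ [r, s] @ v @ [t, z] @ w"
  note cl = triangle_partners(1)[OF code tri]
  have other: "(\<exists>y\<in>F. y \<noteq> x \<and> crossing y = crossing x) \<longleftrightarrow> partner x \<in> F"
    if "F \<subseteq> ?S" "x \<in> ?S" for F x
  proof
    assume "\<exists>y\<in>F. y \<noteq> x \<and> crossing y = crossing x"
    then obtain y where "y \<in> F" "y \<noteq> x" "crossing y = crossing x"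
      by blast
    moreover have "x \<in> set ?w" "y \<in> set ?w"
      using that \<open>y \<in> F\<close> by auto
    ultimately show "partner x \<in> F"
      using same_crossing[OF code, of x y] by blast
  next
    assume "partner x \<in> F"
    then show "\<exists>y\<in>F. y \<noteq> x \<and> crossing y = crossing x"
      by (intro bexI[of _ "partner x"]) simp_all
  qed
  have split: "y \<in> ?F' \<longleftrightarrow> y \<notin> ?F" if "y \<in> ?S" for y
    using code_distinct[OF code] that by auto
  have "corner_on_left ?F' x \<longleftrightarrow> \<not> corner_on_left ?F x" if x: "x \<in> ?S" for x
  proof -
    have "partner x \<in> ?F' \<longleftrightarrow> partner x \<notin> ?F"
      using cl x by (intro split) blast
    then show ?thesis
      unfolding corner_on_left_def using other[of ?F x] other[of ?F' x] x by auto
  qed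
  then have iff: "corner_on_left ?F' y = corner_on_left ?F' x"
    if "corner_on_left ?F x = corner_on_left ?F y" "x \<in> ?S" "y \<in> ?S" for x y
    using that by blast
  have S: "{q, p, s, r, z, t} = ?S"
    by auto
  note T = tri[unfolded triangle_def Let_def]
  show ?thesis
    unfolding triangle_def Let_def S
  proof (intro conjI)
    show "corner_on_left ?F' q = corner_on_left ?F' p"
      by (rule iff) (use T in simp_all)
    show "corner_on_left ?F' s = corner_on_left ?F' r"
      by (rule iff) (use T in simp_all)
    show "corner_on_left ?F' z = corner_on_left ?F' t"
      by (rule iff) (use T in simp_all)
  qed (use T in simp_all)
qed

lemma triangle_rotate: "triangle p q t z r s \<longleftrightarrow> triangle p q r s t z"
proof -
  have "{p, q, t, z, r, s} = {p, q, r, s, t, z}" "{p, t, r} = {p, r, t}"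
    by auto
  then show ?thesis
    unfolding triangle_def Let_def by (simp only:) blast
qed

text \<open>
  The four cases are the positions of the crossings with the top strand on the two lower strands.
  The over-strand at the third crossing \<open>l\<close> passes it on the other side of the top strand after
  the slide, so the colour of \<open>l\<close> becomes that of the opposite end of this strand.
\<close>

lemma triangle_signs1:
  assumes "i \<noteq> j" "l \<noteq> i" "l \<noteq> j"
    "triangle (Passage i Over d) (Passage j Over d')
      (Passage i Under (\<not> d)) (Passage l e h)
      (Passage j Under (\<not> d')) (Passage l (opposite e) (\<not> h))"
  shows "d' = d \<and> h = d"
  using assms
  by (cases d; cases d'; cases h; simp_all only: triangle_def corner_on_left_def Let_def)
    (simp_all del: card.insert)

text \<open>With the signs forced by the triangle, equality of the end colours is
  self-distributivity: for \<open>d\<close> true and \<open>e = Over\<close> it reads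
  \<open>f (f a b) (f a c) = f a (f b c)\<close>. The other signs and roles give the variants with
  \<open>g\<close>.\<close>

lemma (in quandle) slides_case1:
  assumes "i \<noteq> j" "l \<noteq> i" "l \<noteq> j" "e = Over \<or> e = Under"
  shows "slides f g (Passage i Over d) (Passage j Over d)
      (Passage i Under (\<not> d)) (Passage l e d)
      (Passage j Under (\<not> d)) (Passage l (opposite e) (\<not> d))"
  unfolding slides_def
proof (intro allI impI, goal_cases)
  case (1 k a a' b b' c c')
  then show ?case
    using assms
    by (intro exI[of _ "k(l := if e = Over then b else c)"];
        cases d; elim disjE; simp add: pass_def act_by_image;
        elim conjE; hypsubst?; simp add: act_by_image)
qed

lemma triangle_signs2:
  assumes "i \<noteq> j" "l \<noteq> i" "l \<noteq> j"
    "triangle (Passage i Over d) (Passage j Over d')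
      (Passage l e h) (Passage i Under (\<not> d))
      (Passage j Under (\<not> d')) (Passage l (opposite e) (\<not> h))"
  shows "d' = (\<not> d) \<and> h = d"
  using assms
  by (cases d; cases d'; cases h; simp_all only: triangle_def corner_on_left_def Let_def)
    (simp_all del: card.insert)

lemma (in quandle) slides_case2:
  assumes "i \<noteq> j" "l \<noteq> i" "l \<noteq> j" "e = Over \<or> e = Under"
  shows "slides f g (Passage i Over d) (Passage j Over (\<not> d))
      (Passage l e d) (Passage i Under (\<not> d))
      (Passage j Under (\<not> (\<not> d))) (Passage l (opposite e) (\<not> d))"
  unfolding slides_def
proof (intro allI impI, goal_cases)
  case (1 k a a' b b' c c')
  then show ?case
    using assms
    \<comment> \<open>After the slide \<open>l\<close> comes second on the first lower strand and
      first on the other, hence the end colour \<open>b'\<close> or the start colour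
      \<open>c\<close>.\<close>
    by (intro exI[of _ "k(l := if e = Over then b' else c)"];
        cases d; elim disjE; simp add: pass_def act_by_image;
        elim conjE; hypsubst?; simp add: act_by_image)
qed

lemma triangle_signs3:
  assumes "i \<noteq> j" "l \<noteq> i" "l \<noteq> j"
    "triangle (Passage i Over d) (Passage j Over d')
      (Passage i Under (\<not> d)) (Passage l e h)
      (Passage l (opposite e) (\<not> h)) (Passage j Under (\<not> d'))"
  shows "d' = (\<not> d) \<and> h = (\<not> d)"
  using assms
  by (cases d; cases d'; cases h; simp_all only: triangle_def corner_on_left_def Let_def)
    (simp_all del: card.insert)

lemma (in quandle) slides_case3:
  assumes "i \<noteq> j" "l \<noteq> i" "l \<noteq> j" "e = Over \<or> e = Under"
  shows "slides f g (Passage i Over d) (Passage j Over (\<not> d))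
      (Passage i Under (\<not> d)) (Passage l e (\<not> d))
      (Passage l (opposite e) (\<not> (\<not> d))) (Passage j Under (\<not> (\<not> d)))"
  unfolding slides_def
proof (intro allI impI, goal_cases)
  case (1 k a a' b b' c c')
  then show ?case
    using assms
    by (intro exI[of _ "k(l := if e = Over then b else c')"];
        cases d; elim disjE; simp add: pass_def act_by_image;
        elim conjE; hypsubst?; simp add: act_by_image)
qed

lemma triangle_signs4:
  assumes "i \<noteq> j" "l \<noteq> i" "l \<noteq> j"
    "triangle (Passage i Over d) (Passage j Over d')
      (Passage l e h) (Passage i Under (\<not> d))
      (Passage l (opposite e) (\<not> h)) (Passage j Under (\<not> d'))"
  shows "d' = d \<and> h = (\<not> d)"
  using assms
  by (cases d; cases d'; cases h; simp_all only: triangle_def corner_on_left_def Let_def)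
    (simp_all del: card.insert)

lemma (in quandle) slides_case4:
  assumes "i \<noteq> j" "l \<noteq> i" "l \<noteq> j" "e = Over \<or> e = Under"
  shows "slides f g (Passage i Over d) (Passage j Over d)
      (Passage l e (\<not> d)) (Passage i Under (\<not> d))
      (Passage l (opposite e) (\<not> (\<not> d))) (Passage j Under (\<not> d))"
  unfolding slides_def
proof (intro allI impI, goal_cases)
  case (1 k a a' b b' c c')
  then show ?case
    using assms
    by (intro exI[of _ "k(l := if e = Over then b' else c')"];
        cases d; elim disjE; simp add: pass_def act_by_image;
        elim conjE; hypsubst?; simp add: act_by_image)
qed

lemma (in quandle) slides_R3_aux:
  assumes cl: "\<forall>x\<in>{p, q, r, s, t, z}. partner x \<in> {p, q, r, s, t, z}"
    and dist: "distinct [p, q, r, s, t, z]"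
    and tri: "triangle p q r s t z"
    and over: "role p = Over" "role q = Over"
    and classical: "role ` {p, q, r, s, t, z} = {Over, Under}"
    and p: "partner p \<in> {r, s}"
  shows "slides f g p q r s t z"
proof -
  obtain x y where rs: "(partner p, x) \<in> {(r, s), (s, r)}"
    and tz: "(partner q, y) \<in> {(t, z), (z, t)}" and y: "y = partner x"
    and ne: "crossing p \<noteq> crossing q" "crossing x \<noteq> crossing p" "crossing x \<noteq> crossing q"
    using triangle_pairing[OF cl dist tri p] .
  obtain i d where p_eq: "p = Passage i Over d"
    using over(1) by (cases p) auto
  obtain j d' where q_eq: "q = Passage j Over d'"
    using over(2) by (cases q) auto
  obtain l e h where x_eq: "x = Passage l e h"
    by (cases x) auto
  have e: "e = Over \<or> e = Under"
  proof -
    have "x \<in> {p, q, r, s, t, z}"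
      using rs by auto
    then have "role x \<in> {Over, Under}"
      using classical by blast
    then show ?thesis
      by (simp add: x_eq)
  qed
  have pp: "partner p = Passage i Under (\<not> d)" and pq: "partner q = Passage j Under (\<not> d')"
    and py: "y = Passage l (opposite e) (\<not> h)"
    by (simp_all add: p_eq q_eq x_eq y partner_def)
  have ij: "i \<noteq> j" "l \<noteq> i" "l \<noteq> j"
    using ne by (simp_all add: p_eq q_eq x_eq)
  consider "r = partner p" "s = x" "t = partner q" "z = y"
    | "r = x" "s = partner p" "t = partner q" "z = y"
    | "r = partner p" "s = x" "t = y" "z = partner q"
    | "r = x" "s = partner p" "t = y" "z = partner q"
    using rs tz by auto
  then show ?thesis
  proof cases
    case 1
    show ?thesis
      using triangle_signs1[OF ij tri[unfolded 1 pp pq, unfolded p_eq q_eq x_eq py]] slides_case1[OF ij e]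
      unfolding 1 pp pq unfolding p_eq q_eq x_eq py by simp
  next
    case 2
    show ?thesis
      using triangle_signs2[OF ij tri[unfolded 2 pp pq, unfolded p_eq q_eq x_eq py]] slides_case2[OF ij e]
      unfolding 2 pp pq unfolding p_eq q_eq x_eq py by simp
  next
    case 3
    show ?thesis
      using triangle_signs3[OF ij tri[unfolded 3 pp pq, unfolded p_eq q_eq x_eq py]] slides_case3[OF ij e]
      unfolding 3 pp pq unfolding p_eq q_eq x_eq py by simp
  next
    case 4
    show ?thesis
      using triangle_signs4[OF ij tri[unfolded 4 pp pq, unfolded p_eq q_eq x_eq py]] slides_case4[OF ij e]
      unfolding 4 pp pq unfolding p_eq q_eq x_eq py by simp
  qed
qed

lemma (in quandle) slides_R3:
  assumes code: "signed_gauss_code ([p, q] @ u @ [r, s] @ v @ [t, z] @ w)"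
    and tri: "triangle p q r s t z"
    and over: "role p = Over" "role q = Over"
    and classical: "role ` {p, q, r, s, t, z} = {Over, Under}"
  shows "slides f g p q r s t z"
proof -
  note cl = triangle_partners(1)[OF code tri]
  have dist: "distinct [p, q, r, s, t, z]" "distinct [p, q, t, z, r, s]"
    using code_distinct[OF code] by auto
  have perm: "{p, q, t, z, r, s} = {p, q, r, s, t, z}"
    by auto
  note cl' = cl[folded perm] and classical' = classical[folded perm]
    and tri' = triangle_rotate[THEN iffD2, OF tri]
  have "partner p \<noteq> q"
    using over by (metis partner_simps(2) opposite_simps(1) role.distinct(1))
  then have "partner p \<in> {r, s} \<or> partner p \<in> {t, z}"
    using cl by auto
  then show ?thesis
  proof
    assume "partner p \<in> {r, s}"
    then show ?thesis
      by (rule slides_R3_aux[OF cl dist(1) tri over classical])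
  next
    assume "partner p \<in> {t, z}"
    then show ?thesis
      by (rule slides_swap[OF slides_R3_aux[OF cl' dist(2) tri' over classical']])
  qed
qed

lemma slides_vR3:
  assumes "role ` {p, q, r, s, t, z} = {Virtual}"
  shows "slides f g p q r s t z"
proof -
  have "role q = Virtual" "role s = Virtual" "role z = Virtual"
    using assms by auto
  then show ?thesis
    by (intro slides_commuting; metis colors_virtual_swap)
qed

text \<open>
  In the moves \<open>vR4\<close> and \<open>Fo\<close> every strand other than \<open>p q\<close> has a virtual passage, so that
  reversing the order of its passages has no effect on colours.
\<close>

lemma slides_mixed:
  assumes code: "signed_gauss_code ([p, q] @ u @ [r, s] @ v @ [t, z] @ w)"
    and tri: "triangle p q r s t z"
    and pq: "role p = Virtual \<and> role q = Virtual \<or>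
      role p = Over \<and> role q = Over \<and> Virtual \<in> role ` {p, q, r, s, t, z}"
  shows "slides f g p q r s t z"
proof -
  note cl = triangle_partners(1)[OF code tri]
  have dist: "distinct [p, q, r, s, t, z]" "distinct [p, q, t, z, r, s]"
    using code_distinct[OF code] by auto
  have perm: "{p, q, t, z, r, s} = {p, q, r, s, t, z}"
    by auto
  note cl' = cl[folded perm] and tri' = triangle_rotate[THEN iffD2, OF tri]
  have "partner p \<noteq> q"
    using tri unfolding triangle_def by auto
  then have "partner p \<in> {r, s} \<or> partner p \<in> {t, z}"
    using cl by auto
  \<comment> \<open>If \<open>p\<close> and \<open>q\<close> are virtual, their partners supply the
    virtual passages. If they are over-passages, the virtual crossing must be the third one, which
    lies on both lower strands.\<close>
  then have "(role r = Virtual \<or> role s = Virtual) \<and> (role t = Virtual \<or> role z = Virtual)"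
  proof
    assume "partner p \<in> {r, s}"
    then obtain x y where "(partner p, x) \<in> {(r, s), (s, r)}"
        "(partner q, y) \<in> {(t, z), (z, t)}" "y = partner x"
      using triangle_pairing[OF cl dist(1) tri] by metis
    then show ?thesis
      using pq by (auto simp: image_iff eq_commute[of Virtual])
  next
    assume "partner p \<in> {t, z}"
    then obtain x y where "(partner p, x) \<in> {(t, z), (z, t)}"
        "(partner q, y) \<in> {(r, s), (s, r)}" "y = partner x"
      using triangle_pairing[OF cl' dist(2) tri'] by metis
    then show ?thesis
      using pq by (auto simp: image_iff eq_commute[of Virtual])
  qed
  moreover have "colors f g k a [p, q] b \<longleftrightarrow> colors f g k a [q, p] b" for k a b
    using pq by (metis colors_virtual_swap colors_over_swap)
  ultimately show ?thesis
    by (intro slides_commuting; metis colors_virtual_swap)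
qed

text \<open>The three crossings of the triangle occur nowhere else, so changing \<open>k\<close>
  there leaves the colouring of \<open>u\<close>, \<open>v\<close> and \<open>w\<close> intact, and
  the pieces fit together at the unchanged end colours.\<close>

lemma rigid_slide:
  assumes code: "signed_gauss_code ([p, q] @ u @ [r, s] @ v @ [t, z] @ w)"
    and tri: "triangle p q r s t z"
    and slides: "slides f g p q r s t z"
    and rigid: "rigid f g ([q, p] @ u @ [s, r] @ v @ [z, t] @ w)"
  shows "rigid f g ([p, q] @ u @ [r, s] @ v @ [t, z] @ w)"
proof (rule rigidI[OF _ rigid])
  let ?S = "{p, q, r, s, t, z}"
  fix k a assume "colors f g k a ([p, q] @ u @ [r, s] @ v @ [t, z] @ w) a"
  then obtain a1 a2 a3 a4 a5 where
    c: "colors f g k a [p, q] a1" "colors f g k a1 u a2" "colors f g k a2 [r, s] a3"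
      "colors f g k a3 v a4" "colors f g k a4 [t, z] a5" "colors f g k a5 w a"
    unfolding colors_append by blast
  then obtain k' where k': "\<forall>i. i \<notin> crossing ` ?S \<longrightarrow> k' i = k i"
      "colors f g k' a [q, p] a1" "colors f g k' a2 [s, r] a3" "colors f g k' a4 [z, t] a5"
      "\<forall>e. mono_over k' e [q, p, s, r, z, t] \<longrightarrow> mono_over k e [p, q, r, s, t, z]"
    using slides unfolding slides_def by blast
  have agree: "k' (crossing x) = k (crossing x)" if "x \<in> set (u @ v @ w)" for x
    using k'(1) triangle_partners(2)[OF code tri that] by blast
  have "colors f g k' a1 u a2" "colors f g k' a3 v a4" "colors f g k' a5 w a"
    using c colors_cong[of u k' k f g a1 a2] colors_cong[of v k' k f g a3 a4]
      colors_cong[of w k' k f g a5 a] agree by simp_all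
  then have "colors f g k' a ([q, p] @ u @ [s, r] @ v @ [z, t] @ w) a"
    using k'(2,3,4) unfolding colors_append by blast
  moreover have "mono_over k a ([p, q] @ u @ [r, s] @ v @ [t, z] @ w)"
    if "mono_over k' a ([q, p] @ u @ [s, r] @ v @ [z, t] @ w)"
  proof -
    have "mono_over k' a ([q, p, s, r, z, t])" and "mono_over k' a (u @ v @ w)"
      by (rule mono_over_subset[OF that]; auto)+
    then have "mono_over k a [p, q, r, s, t, z]" and "mono_over k a (u @ v @ w)"
      using k'(5) mono_over_cong[of "u @ v @ w" k' k a] agree by blast+
    then have "mono_over k a ([p, q, r, s, t, z] @ u @ v @ w)"
      unfolding mono_over_simps(3) by blast
    then show ?thesis
      by (rule mono_over_subset) auto
  qed
  ultimately show "\<exists>k' a'. colors f g k' a' ([q, p] @ u @ [s, r] @ v @ [z, t] @ w) a' \<and>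
      (mono_over k' a' ([q, p] @ u @ [s, r] @ v @ [z, t] @ w) \<longrightarrow>
        mono_over k a ([p, q] @ u @ [r, s] @ v @ [t, z] @ w))"
    by blast
qed

section \<open>Rigidity as an invariant of welded knots\<close>

text \<open>All quandles on the type are taken together because reversing the orientation trades a
  quandle for its dual; rigidity in one fixed quandle would not visibly survive that move.\<close>

definition always_rigid :: "'a itself \<Rightarrow> passage list \<Rightarrow> bool" where
  "always_rigid _ w \<longleftrightarrow> (\<forall>f g. quandle (f :: 'a \<Rightarrow> 'a \<Rightarrow> 'a) g \<longrightarrow> rigid f g w)"

lemma always_rigid_slide:
  assumes codes: "signed_gauss_code ([p, q] @ u @ [r, s] @ v @ [t, z] @ w)"
      "signed_gauss_code ([q, p] @ u @ [s, r] @ v @ [z, t] @ w)"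
    and tri: "triangle p q r s t z"
    and slides: "\<And>f g :: 'a \<Rightarrow> 'a \<Rightarrow> 'a. quandle f g \<Longrightarrow>
      slides f g p q r s t z \<and> slides f g q p s r z t"
  shows "always_rigid TYPE('a) ([p, q] @ u @ [r, s] @ v @ [t, z] @ w) \<longleftrightarrow>
    always_rigid TYPE('a) ([q, p] @ u @ [s, r] @ v @ [z, t] @ w)"
  unfolding always_rigid_def
  using rigid_slide[OF codes(1) tri] rigid_slide[OF codes(2) triangle_flip[OF codes(1) tri]] slides
  by metis

lemma always_rigid_move:
  assumes "move v w" "signed_gauss_code v" "signed_gauss_code w"
  shows "always_rigid TYPE('a) v \<longleftrightarrow> always_rigid TYPE('a) w"
  using assms
proof cases
  case (base_point u v)
  then show ?thesis
    using assms quandle.rigid_base_point unfolding always_rigid_def by metis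
next
  case reversal
  then show ?thesis
    unfolding always_rigid_def by (metis quandle.rigid_reversal quandle.dual)
next
  case (renaming h)
  then show ?thesis
    unfolding always_rigid_def using rigid_rename by metis
next
  case (R1 x y)
  then show ?thesis
    using assms(2) unfolding always_rigid_def by (metis quandle.rigid_R1)
next
  case (vR1 x y)
  then show ?thesis
    unfolding always_rigid_def by (metis quandle.rigid_vR1)
next
  case (R2 p q r s u' v')
  then show ?thesis
    using assms(2) unfolding always_rigid_def by (metis quandle.rigid_R2)
next
  case (vR2 p q r s u' v')
  then show ?thesis
    unfolding always_rigid_def by (metis quandle.rigid_vR2)
next
  case (R3 p q r s t z u' v' w')
  have perm: "{q, p, s, r, z, t} = {p, q, r, s, t, z}"
    by auto
  note codes = assms(2,3)[unfolded R3(1,2)]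
  show ?thesis
    unfolding R3(1,2)
    by (intro always_rigid_slide codes R3 conjI quandle.slides_R3[OF _ codes(1)]
        quandle.slides_R3[OF _ codes(2) triangle_flip[OF codes(1)]])
      (use R3 perm in auto)
next
  case (vR3 p q r s t z u' v' w')
  have perm: "{q, p, s, r, z, t} = {p, q, r, s, t, z}"
    by auto
  note codes = assms(2,3)[unfolded vR3(1,2)]
  show ?thesis
    unfolding vR3(1,2)
    by (intro always_rigid_slide codes vR3 conjI slides_vR3) (use vR3 perm in auto)
next
  case (vR4 p q r s t z u' v' w')
  note codes = assms(2,3)[unfolded vR4(1,2)]
  show ?thesis
    unfolding vR4(1,2)
    by (intro always_rigid_slide codes vR4 conjI slides_mixed[OF codes(1)]
        slides_mixed[OF codes(2) triangle_flip[OF codes(1)]])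
      (use vR4 in auto)
next
  case (Fo p q r s t z u' v' w')
  have perm: "{q, p, s, r, z, t} = {p, q, r, s, t, z}"
    by auto
  note codes = assms(2,3)[unfolded Fo(1,2)]
  show ?thesis
    unfolding Fo(1,2)
    by (intro always_rigid_slide codes Fo conjI slides_mixed[OF codes(1)]
        slides_mixed[OF codes(2) triangle_flip[OF codes(1)]])
      (use Fo perm in auto)
qed

lemma always_rigid_welded_knot:
  assumes "D \<in> welded_knot w" "always_rigid TYPE('a) w"
  shows "always_rigid TYPE('a) D"
proof -
  have "equivclp welded_step w D"
    using assms(1) by (simp add: welded_knot_def)
  then show ?thesis
  proof (induction rule: equivclp_induct)
    case (step y z)
    then show ?case
      using always_rigid_move unfolding welded_step_def virtual_knot_diagram_def by blast
  qed (rule assms(2))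
qed

lemma code_welded_knot:
  assumes "D \<in> welded_knot w" "signed_gauss_code w"
  shows "signed_gauss_code D"
proof -
  have "equivclp welded_step w D"
    using assms(1) by (simp add: welded_knot_def)
  then show ?thesis
  proof (induction rule: equivclp_induct)
    case (step y z)
    then show ?case
      unfolding welded_step_def virtual_knot_diagram_def by blast
  qed (rule assms(2))
qed

section \<open>The welded torus diagram\<close>

text \<open>\<open>x i\<close> and \<open>y i\<close> are the colours before level \<open>i\<close>
  on the passes starting on the left and on the right. An odd braid exchanges its strands, so the
  closure joins the end of each pass to the start of the other.\<close>

lemma (in quandle) welded_braid_colors:
  assumes "odd m" "c < m" and closed: "x m = y 0" "y m = x 0"
    and even: "\<And>i. i < m \<Longrightarrow> i \<noteq> c \<Longrightarrow> even i \<Longrightarrow> x (Suc i) = x i \<and> y (Suc i) = f (x i) (y i)"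
    and odd: "\<And>i. i < m \<Longrightarrow> i \<noteq> c \<Longrightarrow> odd i \<Longrightarrow> y (Suc i) = y i \<and> x (Suc i) = f (y i) (x i)"
    and weld: "x (Suc c) = x c" "y (Suc c) = y c"
    and "i \<le> m"
  shows "x i = x 0 \<and> y i = x 0"
proof -
  \<comment> \<open>The operator of the strand that is over at level \<open>i\<close> is applied
    last. A classical crossing conjugates the other operator by it and then exchanges the parts of
    the strands, so the composite is conserved.\<close>
  define F where "F i z = (if even i then f (x i) (f (y i) z) else f (y i) (f (x i) z))" for i z
  have F_Suc: "F (Suc i) = F i" if "i < m" "i \<noteq> c" for i
    using even[OF that] odd[OF that] by (auto simp: F_def act_by_image fun_eq_iff)
  have F_left: "F i = F 0" if "i \<le> c" for i
    using that
  proof (induction i)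
    case (Suc i)
    then show ?case
      using F_Suc[of i] \<open>c < m\<close> by simp
  qed simp
  have F_right: "F i = F (Suc c)" if "Suc c \<le> i" "i \<le> m" for i
    using that
  proof (induction i rule: dec_induct)
    case (step i)
    then show ?case
      using F_Suc[of i] by simp
  qed simp
  \<comment> \<open>The closure exchanges \<open>x\<close> with \<open>y\<close>, and the oddness of
    \<open>m\<close> exchanges the order of the factors; the two effects cancel.\<close>
  have "F m = F 0"
    using closed \<open>odd m\<close> by (simp add: F_def fun_eq_iff)
  then have F_c: "F c = F (Suc c)"
    using F_left[of c] F_right[of m] \<open>c < m\<close> by simp
  define C where "C i \<longleftrightarrow> (\<forall>z. f (x i) (f (y i) z) = f (y i) (f (x i) z))" for i
  \<comment> \<open>The welded crossing changes the parity of the level but neither colour, so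
    \<open>F (Suc c)\<close> is \<open>F c\<close> with its factors swapped.\<close>
  have "C c"
    using F_c weld unfolding C_def F_def fun_eq_iff by (cases "even c") auto
  \<comment> \<open>Conjugation by a commuting operator does nothing: the new under-colour may
    differ from the old one, but its operator does not.\<close>
  have conj: "f (f u v) = f v" if "\<forall>z. f u (f v z) = f v (f u z)" for u v
    using that by (simp add: act_by_image fun_eq_iff)
  have act_Suc: "f (x (Suc i)) = f (x i) \<and> f (y (Suc i)) = f (y i)" if "C i" "i < m" for i
    using that conj[of "x i" "y i"] conj[of "y i" "x i"] even[of i] odd[of i] weld
    by (cases "i = c"; cases "even i") (auto simp: C_def)
  have C_Suc: "C (Suc i)" if "C i" "i < m" for i
    using that(1) act_Suc[OF that] by (simp add: C_def)
  have C_right: "C i" if "c \<le> i" "i \<le> m" for i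
    using that
  proof (induction i rule: dec_induct)
    case (step i)
    then show ?case
      using C_Suc[of i] by simp
  qed (rule \<open>C c\<close>)
  \<comment> \<open>Commutation is propagated forwards only, from \<open>c\<close> to
    \<open>m\<close>; the closure carries it on to level \<open>0\<close> and thus to the levels
    before \<open>c\<close>.\<close>
  have "C 0"
    using C_right[of m] \<open>c < m\<close> closed by (simp add: C_def)
  have C: "C i" if "i \<le> m" for i
    using that
  proof (induction i)
    case (Suc i)
    then show ?case
      using C_Suc[of i] by simp
  qed (rule \<open>C 0\<close>)
  have act: "f (x i) = f (x 0) \<and> f (y i) = f (y 0)" if "i \<le> m" for i
    using that
  proof (induction i)
    case (Suc i)
    then show ?case
      using act_Suc[of i] C[of i] by simp
  qed simp
  \<comment> \<open>The operator is constant along each pass, and the first pass ends in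
    \<open>y 0\<close>.\<close>
  have same: "f (y 0) = f (x 0)"
    using act[of m] closed(1) by simp
  have const: "x i = x 0 \<and> y i = y 0" if "i \<le> m" for i
    using that
  proof (induction i)
    case (Suc i)
    \<comment> \<open>As \<open>x i\<close> and \<open>y i\<close> have the same operator, each acts
      on the other as the other acts on itself.\<close>
    have "f (x i) (y i) = y i" "f (y i) (x i) = x i"
      using act[of i] same Suc.prems idem[of "y i"] idem[of "x i"] by simp_all
    then show ?case
      using Suc even[of i] odd[of i] weld by (cases "i = c"; cases "even i") auto
  qed simp
  have "y 0 = x 0"
    using closed(1) const[of m] by (metis order_refl)
  then show ?thesis
    using const[OF \<open>i \<le> m\<close>] by simp
qed

text \<open>Describes the first run through the braid only: the second takes the other branch at
  every level, so it is the \<open>partner\<close> image. Welding keeps the local orientation, hence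
  the entry \<open>even i\<close> also at \<open>c\<close>.\<close>

definition welded_pass :: "nat \<Rightarrow> nat \<Rightarrow> passage" where
  "welded_pass c i =
     Passage i (if i = c then Virtual else if even i then Over else Under) (even i)"

lemma weld_torus_diagram:
  "weld c (torus_diagram n) =
     map (welded_pass c) [0..<2 * n + 1] @ map (partner \<circ> welded_pass c) [0..<2 * n + 1]"
  by (auto simp: weld_def torus_diagram_def braid_pass_def welded_pass_def partner_def)

lemma crossing_welded_pass [simp]: "crossing (welded_pass c i) = i"
  by (simp add: welded_pass_def)

lemma code_weld_torus: "signed_gauss_code (weld c (torus_diagram n))"
proof -
  define m where "m = 2 * n + 1"
  define w where "w = map (welded_pass c) [0..<m] @ map (partner \<circ> welded_pass c) [0..<m]"
  have "welded_pass c i \<noteq> partner (welded_pass c j)" for i j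
    by (metis crossing_welded_pass partner_simps(1,5))
  moreover have "inj_on (welded_pass c) A" "inj_on (partner \<circ> welded_pass c) A" for A
    by (rule inj_onI, metis comp_apply crossing_welded_pass partner_simps(1))+
  ultimately have "distinct w"
    unfolding w_def by (auto simp: distinct_map)
  moreover have "{y \<in> set w. crossing y = crossing x} = {x, partner x}" if "x \<in> set w" for x
    using that unfolding w_def by auto
  ultimately show ?thesis
    unfolding weld_torus_diagram m_def[symmetric] w_def[symmetric] signed_gauss_code_def by blast
qed

text \<open>Unfolds the recursive colouring into the sequence of edge colours, \<open>x i\<close>
  being the colour on arrival at \<open>P i\<close>, as needed for arguing by braid levels.\<close>

lemma colors_map_upt:
  assumes "colors f g k a (map P [0..<m]) b"
  obtains x where "x 0 = a" "x m = b"
    "\<And>i. i < m \<Longrightarrow> role (P i) = Over \<Longrightarrow> k (crossing (P i)) = x i"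
    "\<And>i. i < m \<Longrightarrow> x (Suc i) = pass f g k (P i) (x i)"
  using assms
proof (induction m arbitrary: b thesis)
  case (Suc m)
  from Suc.prems(2) obtain b' where "colors f g k a (map P [0..<m]) b'"
    and b': "role (P m) = Over \<longrightarrow> k (crossing (P m)) = b'" "b = pass f g k (P m) b'"
    by (auto simp: colors_append)
  then obtain x where x: "x 0 = a" "x m = b'"
    "\<And>i. i < m \<Longrightarrow> role (P i) = Over \<Longrightarrow> k (crossing (P i)) = x i"
    "\<And>i. i < m \<Longrightarrow> x (Suc i) = pass f g k (P i) (x i)"
    using Suc.IH by blast
  show ?case
    by (rule Suc.prems(1)[of "x(Suc m := b)"]) (use x b' in \<open>auto simp: less_Suc_eq\<close>)
qed simp

lemma (in quandle) rigid_weld_torus: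
  assumes "c < 2 * n + 1"
  shows "rigid f g (weld c (torus_diagram n))"
  unfolding rigid_def weld_torus_diagram
proof (intro allI impI)
  let ?A = "welded_pass c" and ?m = "2 * n + 1"
  fix k a
  assume "colors f g k a (map ?A [0..<?m] @ map (partner \<circ> ?A) [0..<?m]) a"
  then obtain b where b: "colors f g k a (map ?A [0..<?m]) b"
      "colors f g k b (map (partner \<circ> ?A) [0..<?m]) a"
    unfolding colors_append by blast
  obtain x where x: "x 0 = a" "x ?m = b"
    "\<And>i. i < ?m \<Longrightarrow> role (?A i) = Over \<Longrightarrow> k (crossing (?A i)) = x i"
    "\<And>i. i < ?m \<Longrightarrow> x (Suc i) = pass f g k (?A i) (x i)"
    using colors_map_upt[OF b(1)] by blast
  obtain y where y: "y 0 = b" "y ?m = a"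
    "\<And>i. i < ?m \<Longrightarrow> role ((partner \<circ> ?A) i) = Over \<Longrightarrow> k (crossing ((partner \<circ> ?A) i)) = y i"
    "\<And>i. i < ?m \<Longrightarrow> y (Suc i) = pass f g k ((partner \<circ> ?A) i) (y i)"
    using colors_map_upt[OF b(2)] by blast
  have const: "x i = a \<and> y i = a" if "i < ?m" for i
    unfolding x(1)[symmetric]
  proof (rule welded_braid_colors)
    show "x (Suc i) = x i \<and> y (Suc i) = f (x i) (y i)" if "i < ?m" "i \<noteq> c" "even i" for i
      using x(3,4)[of i] y(4)[of i] that by (simp add: pass_def welded_pass_def)
    show "y (Suc i) = y i \<and> x (Suc i) = f (y i) (x i)" if "i < ?m" "i \<noteq> c" "odd i" for i
      using x(4)[of i] y(3,4)[of i] that by (simp add: pass_def welded_pass_def)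
    show "x (Suc c) = x c" "y (Suc c) = y c"
      using x(4)[of c] y(4)[of c] assms by (simp_all add: pass_def welded_pass_def)
  qed (use x(1,2) y(1,2) assms that in simp_all)
  have "k (crossing (?A i)) = a" if "i < ?m" "role (?A i) \<noteq> Virtual" for i
    using x(3)[of i] y(3)[of i] const[of i] that
    by (cases "role (?A i)") (simp_all)
  then show "mono_over k a (map ?A [0..<?m] @ map (partner \<circ> ?A) [0..<?m])"
    unfolding mono_over_def by auto
qed

section \<open>From colourings to the group\<close>

lemma word_eq_context: "word_eq X R u v \<Longrightarrow> word_eq X R (a @ u @ b) (a @ v @ b)"
proof (induction rule: word_eq.induct)
  case (cancel x u c v)
  then show ?case
    using word_eq.cancel[of x X R "a @ u" c "v @ b"] by simp
next
  case (relation l r u v)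
  then show ?case
    using word_eq.relation[of l r R X "a @ u" "v @ b"] by simp
qed (blast intro: word_eq.intros)+

lemma word_eq_append: "word_eq X R u v \<Longrightarrow> word_eq X R u' v' \<Longrightarrow> word_eq X R (u @ u') (v @ v')"
  using word_eq_context[of X R u v "[]" u'] word_eq_context[of X R u' v' v "[]"]
  by (auto intro: word_eq.trans)

abbreviation words :: "'g set \<Rightarrow> 'g word set" where
  "words X \<equiv> lists (X \<times> UNIV)"

lemma word_class_eq_iff:
  "u \<in> words X \<Longrightarrow> v \<in> words X \<Longrightarrow> word_class X R u = word_class X R v \<longleftrightarrow> word_eq X R u v"
  unfolding word_class_def using word_eq.refl word_eq.sym word_eq.trans
  by (smt (verit, ccfv_threshold) Collect_cong mem_Collect_eq)

text \<open>The product is a union over all representatives; by congruence every member of this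
  union is the same class, and the union is not empty.\<close>

lemma word_class_mult:
  assumes "u \<in> words X" "v \<in> words X"
  shows "word_class X R u \<otimes>\<^bsub>presented_group X R\<^esub> word_class X R v = word_class X R (u @ v)"
proof -
  have "word_class X R (a @ b) = word_class X R (u @ v)"
    if "a \<in> word_class X R u" "b \<in> word_class X R v" for a b
    using that assms word_eq_append[of X R u a v b]
    by (subst word_class_eq_iff) (auto simp: word_class_def intro: word_eq.sym)
  moreover have "word_class X R u \<noteq> {}" "word_class X R v \<noteq> {}"
    using assms by (auto simp: word_class_def intro: word_eq.refl)
  ultimately show ?thesis
    unfolding presented_group_def by (simp add: SUP_eq_const)
qed

lemma one_presented_group: "\<one>\<^bsub>presented_group X R\<^esub> = word_class X R []"
  by (simp add: presented_group_def)

lemma carrier_presented_group: "carrier (presented_group X R) = word_class X R ` words X"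
  by (simp add: presented_group_def)

fun flip :: "'g \<times> bool \<Rightarrow> 'g \<times> bool" where
  "flip (x, b) = (x, \<not> b)"

lemma inverse_word:
  "u \<in> words X \<Longrightarrow> rev (map flip u) \<in> words X \<and> word_eq X R (rev (map flip u) @ u) []"
proof (induction u)
  case (Cons l u)
  obtain x b where l: "l = (x, b)"
    by (cases l)
  have x: "x \<in> X"
    using Cons.prems l by auto
  have "word_eq X R (rev (map flip u) @ [(x, \<not> b), (x, \<not> \<not> b)] @ u) (rev (map flip u) @ u)"
    using x by (rule word_eq.cancel)
  then show ?case
    using Cons x by (auto simp: l intro: word_eq.trans)
qed (auto intro: word_eq.refl)

lemma presented_group_is_group: "group (presented_group X R)"
proof (rule groupI)
  fix A assume "A \<in> carrier (presented_group X R)"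
  then obtain u where u: "u \<in> words X" "A = word_class X R u"
    by (auto simp: carrier_presented_group)
  note inv = inverse_word[OF u(1), of R]
  have "word_class X R (rev (map flip u)) \<otimes>\<^bsub>presented_group X R\<^esub> A = \<one>\<^bsub>presented_group X R\<^esub>"
    unfolding u(2) one_presented_group using inv u(1)
    by (subst word_class_mult) (auto simp: word_class_eq_iff)
  then show "\<exists>B\<in>carrier (presented_group X R).
      B \<otimes>\<^bsub>presented_group X R\<^esub> A = \<one>\<^bsub>presented_group X R\<^esub>"
    using inv by (auto simp: carrier_presented_group)
qed (unfold carrier_presented_group one_presented_group;
    (elim imageE)?; simp add: word_class_mult)+

text \<open>A quandle here lives on a whole type, so conjugation is extended by the trivial action
  whenever an argument lies outside the carrier.\<close>

lemma (in group) quandle_conjugation: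
  "quandle (\<lambda>x y. if x \<in> carrier G \<and> y \<in> carrier G then x \<otimes> y \<otimes> inv x else y)
     (\<lambda>x y. if x \<in> carrier G \<and> y \<in> carrier G then inv x \<otimes> y \<otimes> x else y)"
proof -
  have "a \<otimes> (inv a \<otimes> b) = b" "inv a \<otimes> (a \<otimes> b) = b" if "a \<in> carrier G" "b \<in> carrier G" for a b
    using that by (simp_all add: m_assoc[symmetric])
  then show ?thesis
    by unfold_locales (auto simp: m_assoc inv_mult_group)
qed

lemma inv_word_class:
  assumes "x \<in> X"
  shows "inv\<^bsub>presented_group X R\<^esub> (word_class X R [(x, True)]) = word_class X R [(x, False)]"
proof (rule group.inv_equality[OF presented_group_is_group])
  have "word_eq X R ([(x, False), (x, True)]) []"
    using word_eq.cancel[OF assms, of R "[]" False "[]"] by simp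
  then have "word_class X R [(x, False), (x, True)] = word_class X R []"
    using assms by (subst word_class_eq_iff) auto
  then show "word_class X R [(x, False)] \<otimes>\<^bsub>presented_group X R\<^esub> word_class X R [(x, True)] =
      \<one>\<^bsub>presented_group X R\<^esub>"
    using assms by (simp add: word_class_mult one_presented_group)
qed (use assms in \<open>auto simp: carrier_presented_group\<close>)

section \<open>Exponent sums and infinite cyclic groups\<close>

definition exponent_sum :: "'g word \<Rightarrow> int" where
  "exponent_sum u = (\<Sum>(x, b)\<leftarrow>u. if b then 1 else - 1)"

lemma exponent_sum_simps [simp]:
  "exponent_sum [] = 0"
  "exponent_sum ((x, b) # u) = (if b then 1 else - 1) + exponent_sum u"
  "exponent_sum (u @ v) = exponent_sum u + exponent_sum v"
  by (simp_all add: exponent_sum_def)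

lemma word_eq_exponent_sum:
  assumes "word_eq X R u v" "\<And>l r. (l, r) \<in> R \<Longrightarrow> exponent_sum l = exponent_sum r"
  shows "exponent_sum u = exponent_sum v"
  using assms(1) by induction (use assms(2) in auto)

text \<open>Every word equals the power of the common generator given by its exponent sum, so the
  powers exhaust the group; the sum is constant on classes, so distinct powers differ.\<close>

lemma presented_group_infinite_cyclic:
  assumes z: "z \<in> X" and gens: "\<And>x. x \<in> X \<Longrightarrow> word_eq X R [(x, True)] [(z, True)]"
    and sums: "\<And>l r. (l, r) \<in> R \<Longrightarrow> exponent_sum l = exponent_sum r"
  shows "presented_group X R \<cong> integer_group"
proof -
  define G where "G = presented_group X R"
  interpret group G
    unfolding G_def by (rule presented_group_is_group)
  define a where "a = word_class X R [(z, True)]"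
  have a: "a \<in> carrier G"
    using z by (auto simp: a_def G_def carrier_presented_group)
  have power: "word_class X R u = a [^]\<^bsub>G\<^esub> exponent_sum u" if "u \<in> words X" for u
    using that
  proof (induction rule: lists.induct)
    case Nil
    show ?case
      by (simp add: G_def one_presented_group[symmetric])
  next
    case (Cons l u)
    obtain x b where l: "l = (x, b)"
      by (cases l)
    have x: "x \<in> X" and u: "u \<in> words X"
      using Cons.hyps by (simp_all add: l)
    have "word_class X R [(x, True)] = a"
      unfolding a_def using gens[OF x] x z by (subst word_class_eq_iff) auto
    moreover from this have "word_class X R [(x, False)] = inv\<^bsub>G\<^esub> a"
      using inv_word_class[OF x, of R] by (simp add: G_def)
    ultimately have "word_class X R [l] = a [^]\<^bsub>G\<^esub> (if b then 1 else - 1 :: int)"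
      using a by (cases b) (simp_all add: l int_pow_neg int_pow_1)
    moreover have "word_class X R (l # u) = word_class X R [l] \<otimes>\<^bsub>G\<^esub> word_class X R u"
      using x u word_class_mult[of "[l]" X u R] by (simp add: l G_def)
    ultimately show ?case
      using a Cons.IH by (simp add: l int_pow_mult)
  qed
  have "(\<lambda>m::int. a [^]\<^bsub>G\<^esub> m) \<in> hom integer_group G"
    using a by (auto simp: hom_def integer_group_def int_pow_mult)
  moreover have "inj (\<lambda>m::int. a [^]\<^bsub>G\<^esub> m)"
  proof (rule injI)
    fix m m' :: int assume eq: "a [^]\<^bsub>G\<^esub> m = a [^]\<^bsub>G\<^esub> m'"
    \<comment> \<open>A word in the single letter \<open>z\<close> with exponent sum
      \<open>m\<close>; it is empty for \<open>m = 0\<close>.\<close>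
    define u where "u m = replicate (nat \<bar>m\<bar>) (z, 0 \<le> m)" for m :: int
    have u: "u m \<in> words X" for m
      using z by (auto simp: u_def)
    have "exponent_sum (replicate j (z, b)) = (if b then int j else - int j)" for j b
      by (induction j) auto
    then have sum: "exponent_sum (u m) = m" for m
      by (simp add: u_def)
    have "word_eq X R (u m) (u m')"
      using eq power[OF u, of m] power[OF u, of m'] u word_class_eq_iff by (metis sum)
    then show "m = m'"
      using word_eq_exponent_sum sums sum by metis
  qed
  moreover have "range (\<lambda>m::int. a [^]\<^bsub>G\<^esub> m) = carrier G"
  proof
    show "carrier G \<subseteq> range (\<lambda>m::int. a [^]\<^bsub>G\<^esub> m)"
      unfolding G_def carrier_presented_group using power by (intro image_subsetI) (simp add: G_def)
  qed (use a in auto)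
  ultimately have "(\<lambda>m::int. a [^]\<^bsub>G\<^esub> m) \<in> iso integer_group G"
    by (simp add: iso_def bij_betw_def integer_group_def)
  then show ?thesis
    using group.iso_sym[OF group_integer_group] unfolding is_iso_def G_def by blast
qed

lemma knot_group_infinite_cyclic:
  assumes code: "signed_gauss_code w" and "always_rigid TYPE(nat word set) w"
  shows "knot_group w \<cong> integer_group"
proof -
  define G where "G = knot_group w"
  define X where "X = arcs w"
  define R where "R = wirtinger_relations w"
  have G: "G = presented_group X R"
    by (simp add: G_def knot_group_def X_def R_def)
  interpret group G
    unfolding G by (rule presented_group_is_group)
  define f where "f x y = (if x \<in> carrier G \<and> y \<in> carrier G then x \<otimes>\<^bsub>G\<^esub> y \<otimes>\<^bsub>G\<^esub> inv\<^bsub>G\<^esub> x else y)" for x y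
  define g where "g x y = (if x \<in> carrier G \<and> y \<in> carrier G then inv\<^bsub>G\<^esub> x \<otimes>\<^bsub>G\<^esub> y \<otimes>\<^bsub>G\<^esub> x else y)" for x y
  interpret quandle f g
    using quandle_conjugation unfolding f_def[abs_def] g_def[abs_def] .
  define C where "C i = word_class X R [(arc w i, True)]" for i
  have X: "arc w i \<in> X" if "i \<le> length w" for i
    using that by (auto simp: X_def arcs_def)
  have C_closed: "C i \<in> carrier G" if "i \<le> length w" for i
    using X[OF that] by (auto simp: C_def G carrier_presented_group)
  \<comment> \<open>The colour of the over-arc at \<open>c\<close>. A Gauss code has at most one
    over-passage at each crossing, so at classical crossings the choice is forced.\<close>
  define k where
    "k c = C (SOME i. i < length w \<and> role (w ! i) = Over \<and> crossing (w ! i) = c)" for c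
  have k: "k (crossing (w ! i)) = C i" if i: "i < length w" "role (w ! i) = Over" for i
  proof -
    have "j = i" if j: "j < length w \<and> role (w ! j) = Over \<and> crossing (w ! j) = crossing (w ! i)" for j
    proof -
      have "w ! j = w ! i"
        using same_crossing[OF code, of "w ! i" "w ! j"] i j by auto
      then show ?thesis
        using code_distinct[OF code] i j by (simp add: nth_eq_iff_index_eq)
    qed
    then have "(SOME j. j < length w \<and> role (w ! j) = Over \<and> crossing (w ! j) = crossing (w ! i)) = i"
      using i by (intro some_equality) auto
    then show ?thesis
      by (simp add: k_def)
  qed
  have conj: "word_class X R [(x, True), (y, True), (x, False)] =
      word_class X R [(x, True)] \<otimes>\<^bsub>G\<^esub> word_class X R [(y, True)] \<otimes>\<^bsub>G\<^esub> inv\<^bsub>G\<^esub> (word_class X R [(x, True)])"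
    if "x \<in> X" "y \<in> X" for x y
    using that by (simp add: G inv_word_class word_class_mult)
  have step: "C (Suc i) = pass f g k (w ! i) (C i)" if i: "i < length w" for i
  proof (cases "role (w ! i) = Under")
    case False
    then have "under_passages (take (Suc i) w) = under_passages (take i w)"
      using i by (simp add: under_passages_def take_Suc_conv_app_nth)
    then have "C (Suc i) = C i"
      by (simp add: C_def arc_def)
    with False show ?thesis
      by (simp add: pass_def)
  next
    case True
    have "partner (w ! i) \<in> set w"
      using partner_in_code[OF code] i by simp
    then obtain j where j: "j < length w" "w ! j = partner (w ! i)"
      by (metis in_set_conv_nth)
    have kj: "k (crossing (w ! i)) = C j"
      using k[of j] j True by simp
    have closed: "C i \<in> carrier G" "C (Suc i) \<in> carrier G" "C j \<in> carrier G"
      using C_closed i j by simp_all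
    have XX: "arc w i \<in> X" "arc w (Suc i) \<in> X" "arc w j \<in> X"
      using X i j by simp_all
    have rel: "word_class X R l = word_class X R r" if "(l, r) \<in> R" "l \<in> words X" "r \<in> words X" for l r
      using that word_eq.relation[OF that(1), of X "[]" "[]"] by (subst word_class_eq_iff) auto
    \<comment> \<open>The sign is read at the under-passage, where \<open>from_right\<close> is the
      negation of its value at the over-passage; hence the alternatives are interchanged compared
      with \<open>wirtinger_relations\<close>.\<close>
    have R: "([(if from_right (w ! i) then arc w i else arc w (Suc i), True)],
        [(arc w j, True), (if from_right (w ! i) then arc w (Suc i) else arc w i, True),
         (arc w j, False)]) \<in> R"
      unfolding R_def wirtinger_relations_def mem_Collect_eq prod.case
      by (rule exI[of _ j], rule exI[of _ i]) (use i j True in auto)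
    show ?thesis
    proof (cases "from_right (w ! i)")
      case fr: True
      have "C i = C j \<otimes>\<^bsub>G\<^esub> C (Suc i) \<otimes>\<^bsub>G\<^esub> inv\<^bsub>G\<^esub> (C j)"
        using rel[OF R] XX conj[OF XX(3,2)] fr by (simp add: C_def)
      then have "C i = f (C j) (C (Suc i))"
        using closed by (simp add: f_def)
      then show ?thesis
        by (simp add: pass_def True fr kj)
    next
      case fr: False
      have "C (Suc i) = C j \<otimes>\<^bsub>G\<^esub> C i \<otimes>\<^bsub>G\<^esub> inv\<^bsub>G\<^esub> (C j)"
        using rel[OF R] XX conj[OF XX(3,1)] fr by (simp add: C_def)
      then show ?thesis
        using closed by (simp add: pass_def True fr kj f_def)
    qed
  qed
  have colors: "colors f g k (C 0) (take i w) (C i)" if "i \<le> length w" for i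
    using that
  proof (induction i)
    case (Suc i)
    then have "colors f g k (C 0) (take i w) (C i)" "colors f g k (C i) [w ! i] (C (Suc i))"
      using step[of i] k[of i] by auto
    then show ?case
      using Suc.prems by (auto simp: take_Suc_conv_app_nth colors_append simp del: colors.simps)
  qed simp
  \<comment> \<open>The number of under-passages is \<open>0\<close> modulo itself, so the last edge
    lies on arc \<open>0\<close> again and the colouring closes up.\<close>
  have "C (length w) = C 0"
    by (simp add: C_def arc_def under_passages_def)
  then have "mono_over k (C 0) w"
    using colors[of "length w"] assms(2) quandle_axioms unfolding always_rigid_def rigid_def by auto
  \<comment> \<open>Rigidity speaks of over-arcs only; \<open>colors_mono\<close> extends it to arcs
    that are never on top.\<close>
  then have const: "C i = C 0" if "i \<le> length w" for i
    using colors_mono[OF code _ _ colors[OF that]] by (simp add: set_take_subset)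
  have "presented_group X R \<cong> integer_group"
  proof (rule presented_group_infinite_cyclic)
    show "arc w 0 \<in> X"
      using X by simp
    show "word_eq X R [(x, True)] [(arc w 0, True)]" if x: "x \<in> X" for x
    proof -
      obtain i where "i \<le> length w" "x = arc w i"
        using x by (auto simp: X_def arcs_def)
      then show ?thesis
        using const[of i] X[of i] X[of 0] word_class_eq_iff[of "[(x, True)]" X "[(arc w 0, True)]" R]
        by (simp add: C_def)
    qed
    show "exponent_sum l = exponent_sum r" if "(l, r) \<in> R" for l r
      using that by (auto simp: R_def wirtinger_relations_def)
  qed
  then show ?thesis
    using G G_def by simp
qed

theorem proposition4p1:
  fixes n c :: nat and D :: "passage list"
  assumes "n \<ge> 1"
    and "c < 2 * n + 1"
    and "D \<in> welded_knot (weld c (torus_diagram n))"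
  shows "knot_group D \<cong> integer_group"
proof (rule knot_group_infinite_cyclic)
  show "signed_gauss_code D"
    using code_welded_knot[OF assms(3) code_weld_torus] .
  \<comment> \<open>The type is that of the elements of \<open>knot_group D\<close>, whose
    conjugation quandle will be used; rigidity is established for it on the torus diagram and then
    transported to \<open>D\<close>.\<close>
  have "always_rigid TYPE(nat word set) (weld c (torus_diagram n))"
    unfolding always_rigid_def using quandle.rigid_weld_torus[OF _ assms(2)] by blast
  then show "always_rigid TYPE(nat word set) D"
    using always_rigid_welded_knot[OF assms(3)] by blast
qed

end
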